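(* Let $K$ be a field of characteristic $0$ and let $R_1,R_2,R$ be unital associative PI-algebras over $K$ such that $T(R)=T(R_1)T(R_2)$. If the codimension series $c(R_1,t)$ and $c(R_2,t)$ are rational, then the codimension series $c(R,t)$ is also rational. If $c(R_1,t)$ is rational and $c(R_2,t)$ is algebraic over $\mathbb{C}(t)$, then $c(R,t)$ is also algebraic over $\mathbb{C}(t)$.
   Context: $K\langle X\rangle=K\langle x_1,x_2,\ldots\rangle$ is the free unital associative $K$-algebra of countable rank. An element $f(x_1,\ldots,x_d)\in K\langle X\rangle$ is a polynomial identity for a $K$-algebra $R$ if $f(r_1,\ldots,r_d)=0$ for all $r_1,\ldots,r_d\in R$; $R$ is a PI-algebra if it has a nonzero polynomial identity. The set $T(R)\subset K\langle X\rangle$ of all polynomial identities for $R$ is called the T-ideal of $R$; $T(R_1)T(R_2)$ is the usual product of two-sided ideals of $K\langle X\rangle$. Let $P_n=\mathrm{span}_K\{x_{\sigma(1)}\cdots x_{\sigma(n)}\mid\sigma\in S_n\}\subset K\langle X\rangle$ be the space of multilinear polynomials of degree $n$. The codimension sequence of $R$ is $c_n(R)=\dim_K(P_n/(P_n\cap T(R)))$, $n=0,1,2,\ldots$, and the codimension series of $R$ is the formal power series $c(R,t)=\sum_{n\ge 0}c_n(R)t^n\in\mathbb{C}[[t]]$. A formal power series in $\mathbb{C}[[t]]$ is rational if it is the power series expansion at $0$ of an element of $\mathbb{C}(t)$, and algebraic if it is algebraic over $\mathbb{C}(t)$ (inside $\mathbb{C}((t))$). *)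

theory Defs
  imports
    "HOL-Library.Poly_Mapping"
    "HOL-Combinatorics.Permutations"
    "HOL-Computational_Algebra.Computational_Algebra"
    "Jordan_Normal_Form.VS_Connect"
begin

section \<open>The free unital associative algebra\<close>

text \<open>
  Words in countably many letters form the free monoid under concatenation. The convolution
  product on finitely supported functions on words then makes \<open>'k free_alg\<close> the free unital
  associative algebra over \<open>'k\<close>. The letter \<open>i\<close> stands for the variable \<open>x\<^sub>i\<^sub>+\<^sub>1\<close>.
\<close>

instantiation list :: (type) monoid_add
begin

definition zero_list :: "'a list" where "zero_list = []"

definition plus_list :: "'a list \<Rightarrow> 'a list \<Rightarrow> 'a list" where "plus_list = (@)"

instance
  by standard (simp_all add: zero_list_def plus_list_def)

end

type_synonym 'k free_alg = "nat list \<Rightarrow>\<^sub>0 'k"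

definition free_scale :: "'k::field \<Rightarrow> 'k free_alg \<Rightarrow> 'k free_alg" where
  "free_scale c = Poly_Mapping.map (\<lambda>a. c * a)"

lemma lookup_free_scale:
  "Poly_Mapping.lookup (free_scale c f) w = c * Poly_Mapping.lookup f w"
  by (simp add: free_scale_def Poly_Mapping.map.rep_eq when_def)

interpretation free_alg: vector_space free_scale
  by standard
    (auto intro!: poly_mapping_eqI simp: lookup_free_scale lookup_add algebra_simps)

section \<open>Algebras and polynomial identities\<close>

text \<open>
  The sort \<open>{ring, monoid_mult}\<close> is that of unital rings; unlike \<open>ring_1\<close> it does not
  exclude the zero ring.
\<close>

locale unital_algebra = vector_space scale
  for scale :: "'k::field \<Rightarrow> 'r::{ring,monoid_mult} \<Rightarrow> 'r" +
  assumes scale_mult_left: "scale c x * y = scale c (x * y)"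
    and scale_mult_right: "x * scale c y = scale c (x * y)"

definition eval_free ::
    "('k::field \<Rightarrow> 'r::{ring,monoid_mult} \<Rightarrow> 'r) \<Rightarrow> (nat \<Rightarrow> 'r) \<Rightarrow> 'k free_alg \<Rightarrow> 'r" where
  "eval_free scale r f =
     (\<Sum>w\<in>Poly_Mapping.keys f. scale (Poly_Mapping.lookup f w) (prod_list (map r w)))"

definition T_ideal :: "('k::field \<Rightarrow> 'r::{ring,monoid_mult} \<Rightarrow> 'r) \<Rightarrow> 'k free_alg set" where
  "T_ideal scale = {f. \<forall>r. eval_free scale r f = 0}"

locale PI_algebra = unital_algebra scale
  for scale :: "'k::field \<Rightarrow> 'r::{ring,monoid_mult} \<Rightarrow> 'r" +
  assumes nonzero_identity: "\<exists>f\<in>T_ideal scale. f \<noteq> 0"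

definition ideal_times :: "'a::ring_1 set \<Rightarrow> 'a set \<Rightarrow> 'a set" where
  "ideal_times I J =
     {\<Sum>i<n. a i * b i | (n::nat) a b. \<forall>i<n. a i \<in> I \<and> b i \<in> J}"

section \<open>Codimensions\<close>

definition multilinear :: "nat \<Rightarrow> 'k::field free_alg set" where
  "multilinear n =
     free_alg.span {Poly_Mapping.single (map \<sigma> [0..<n]) 1 | \<sigma>. \<sigma> permutes {..<n}}"

text \<open>
  The quotient \<open>V/U\<close> of subspaces \<open>U \<subseteq> V\<close>, with the cosets \<open>v + U\<close> as elements. The fields
  \<open>mult\<close> and \<open>one\<close> of the module record carry no meaning.
\<close>

definition quotient_space ::
    "('k::field \<Rightarrow> 'v::ab_group_add \<Rightarrow> 'v) \<Rightarrow> 'v set \<Rightarrow> 'v set \<Rightarrow> ('k, 'v set) module" where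
  "quotient_space scale V U =
     \<lparr>carrier = (\<lambda>v. (\<lambda>u. v + u) ` U) ` V,
      mult = undefined, one = undefined,
      zero = U,
      add = (\<lambda>A B. {a + b | a b. a \<in> A \<and> b \<in> B}),
      smult = (\<lambda>c A. {scale c a + u | a u. a \<in> A \<and> u \<in> U})\<rparr>"

lemma vectorspace_quotient_space:
  fixes scale :: "'k::field \<Rightarrow> 'v::ab_group_add \<Rightarrow> 'v"
  assumes "vector_space scale"
    and V: "module.subspace scale V" and U: "module.subspace scale U" and "U \<subseteq> V"
  shows "vectorspace class_ring (quotient_space scale V U)"
proof -
  interpret vector_space scale by fact
  let ?Q = "quotient_space scale V U"
  define C where "C v = (\<lambda>u. v + u) ` U" for v
  have mem: "x \<in> C v \<longleftrightarrow> x - v \<in> U" for x v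
    unfolding C_def by (auto simp: image_iff intro!: bexI[of _ "x - v"])
  have carrier: "carrier ?Q = C ` V" and zero: "\<zero>\<^bsub>?Q\<^esub> = C 0"
    by (simp_all add: quotient_space_def C_def)
  have add: "C v \<oplus>\<^bsub>?Q\<^esub> C w = C (v + w)" for v w
  proof -
    have "\<exists>a b. x = a + b \<and> a \<in> C v \<and> b \<in> C w" if "x \<in> C (v + w)" for x
      by (rule exI[of _ "x - w"], rule exI[of _ w])
        (use that U in \<open>simp add: mem subspace_0 algebra_simps\<close>)
    moreover have "a + b \<in> C (v + w)" if "a \<in> C v" "b \<in> C w" for a b
      using subspace_add[OF U, of "a - v" "b - w"] that by (simp add: mem algebra_simps)
    ultimately show ?thesis by (auto simp: quotient_space_def)
  qed
  have smult: "c \<odot>\<^bsub>?Q\<^esub> C v = C (scale c v)" for c v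
  proof -
    have "\<exists>a u. x = scale c a + u \<and> a \<in> C v \<and> u \<in> U" if "x \<in> C (scale c v)" for x
      by (rule exI[of _ v], rule exI[of _ "x - scale c v"])
        (use that U in \<open>simp add: mem subspace_0\<close>)
    moreover have "scale c a + u \<in> C (scale c v)" if "a \<in> C v" "u \<in> U" for a u
      using subspace_add[OF U subspace_scale[OF U, of "a - v" c], of u] that
      by (simp add: mem algebra_simps)
    ultimately show ?thesis by (auto simp: quotient_space_def)
  qed
  note ops = add smult zero
  have ab: "abelian_group ?Q"
  proof (rule abelian_groupI)
    fix x assume "x \<in> carrier ?Q"
    then obtain v where v: "v \<in> V" "x = C v" by (auto simp: carrier)
    show "\<exists>y\<in>carrier ?Q. y \<oplus>\<^bsub>?Q\<^esub> x = \<zero>\<^bsub>?Q\<^esub>"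
      by (rule bexI[of _ "C (- v)"])
        (use v subspace_neg[OF V] in \<open>auto simp: carrier ops\<close>)
  qed (use V in \<open>auto simp: carrier ops subspace_add add_ac intro!: imageI subspace_0\<close>)
  have "module class_ring ?Q"
    by (rule module.intro[OF class_cring.is_cring ab], unfold_locales)
      (use V in \<open>auto simp: carrier ops subspace_scale scale_left_distrib scale_right_distrib\<close>)
  then show ?thesis
    by (simp add: vectorspace_def class_field)
qed

definition codimension :: "('k::field \<Rightarrow> 'r::{ring,monoid_mult} \<Rightarrow> 'r) \<Rightarrow> nat \<Rightarrow> nat" where
  "codimension scale n =
     vectorspace.dim (class_ring :: 'k ring)
       (quotient_space free_scale (multilinear n) (multilinear n \<inter> T_ideal scale))"

definition codimension_series ::
    "('k::field \<Rightarrow> 'r::{ring,monoid_mult} \<Rightarrow> 'r) \<Rightarrow> complex fps" where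
  "codimension_series scale = Abs_fps (\<lambda>n. of_nat (codimension scale n))"

section \<open>Rational and algebraic power series\<close>

text \<open>The field \<open>\<complex>(t)\<close> as a subfield of \<open>\<complex>((t))\<close>, each element being identified with its
  Laurent expansion at 0.\<close>

definition rational_functions :: "complex fls set" where
  "rational_functions =
     {fps_to_fls (fps_of_poly p) / fps_to_fls (fps_of_poly q) | p q. q \<noteq> 0}"

definition rational_series :: "complex fps \<Rightarrow> bool" where
  "rational_series f \<longleftrightarrow> fps_to_fls f \<in> rational_functions"

definition algebraic_series :: "complex fps \<Rightarrow> bool" where
  "algebraic_series f \<longleftrightarrow>
     (\<exists>P :: complex fls poly. P \<noteq> 0 \<and> (\<forall>i. poly.coeff P i \<in> rational_functions) \<and>
        poly P (fps_to_fls f) = 0)"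

end

theory Submission
  imports
    Defs
    "HOL-Algebra.Finite_Extensions"
    "HOL-Combinatorics.Multiset_Permutations"
begin

no_notation vec_index (infixl "$" 100)

text \<open>
  Let \<open>F\<close> be the free algebra, \<open>F\<^sub>+\<close> its augmentation ideal and \<open>T\<^sub>1\<close>, \<open>T\<^sub>2\<close> the two T-ideals.
  As a left ideal, \<open>T\<^sub>2\<close> is a free \<open>F\<close>-module on a complement \<open>G\<close> of \<open>F\<^sub>+ T\<^sub>2\<close>, and \<open>T\<^sub>1 T\<^sub>2\<close> is
  the direct sum of the translates \<open>T\<^sub>1 g\<close>. Comparing with the special case \<open>T\<^sub>1 = F\<close>, the exponential
  generating functions of the multilinear dimensions satisfy \<open>D(T\<^sub>1 T\<^sub>2) = D(T\<^sub>1) (1 - t) D(T\<^sub>2)\<close>.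
  For the codimensions this means that the exponential series of \<open>R\<close> is
  \<open>c\<^sub>1 + c\<^sub>2 + (t - 1) c\<^sub>1 c\<^sub>2\<close>.

  Passing back to ordinary series turns the product into the shuffle product. A rational series is a
  linear combination of powers of the series \<open>t / (1 - a t)\<close>; by the Laplace transforms of
  \<open>t\<^sup>k exp (a t) f\<close>, shuffling with it is a combination of derivations, substitutions \<open>t / (1 - a t)\<close>
  for \<open>t\<close> and multiplications by rational series, which preserve rationality and algebraicity.
\<close>

section \<open>Laplace transform and shuffle product of power series\<close>

text \<open>Why one factor has to be rational: the shuffle product of two algebraic series can be
  transcendental. The Borel transform of \<open>(1 - 4 t^2)^(-1/2)\<close> is the sum of
  \<open>t^(2n) / (n!)^2\<close>, and shuffling this series with itself gives the sum of
  \<open>(2n choose n)^2 t^(2n)\<close>, a complete elliptic integral. Rational series escape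
  because their Borel transforms are exponential polynomials.

  On the algebraic side everything is done inside multilinear components, one finite-dimensional
  space for each finite set of letters. Characteristic 0 makes this legitimate: the multilinear
  parts of an identity are again identities, so a sum of arbitrary products can be replaced by
  products of multilinear factors on complementary letter sets. Such splittings are counted by
  binomial coefficients, which is why exponential series multiply. The dimensions of
  \<open>F_+ T_2\<close> never have to be computed: \<open>F T_2 = T_2\<close> and the series
  \<open>1 / (1 - t)\<close> of \<open>F\<close> already determine how many generators there
  are.\<close>

definition fps_laplace :: "'a::field_char_0 fps \<Rightarrow> 'a fps" where
  "fps_laplace f = Abs_fps (\<lambda>n. fact n * f $ n)"

definition fps_borel :: "'a::field_char_0 fps \<Rightarrow> 'a fps" where
  "fps_borel f = Abs_fps (\<lambda>n. f $ n / fact n)"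

definition geom_fps :: "'a::field_char_0 \<Rightarrow> 'a fps" where
  "geom_fps a = inverse (1 - fps_const a * fps_X)"

definition moebius_fps :: "'a::field_char_0 \<Rightarrow> 'a fps" where
  "moebius_fps a = fps_X * geom_fps a"

lemma laplace_borel [simp]: "fps_laplace (fps_borel f) = f"
  by (simp add: fps_eq_iff fps_laplace_def fps_borel_def)

lemma borel_laplace [simp]: "fps_borel (fps_laplace f) = f"
  by (simp add: fps_eq_iff fps_laplace_def fps_borel_def)

lemma laplace_add: "fps_laplace (f + g) = fps_laplace f + fps_laplace g"
  and laplace_const: "fps_laplace (fps_const c * f) = fps_const c * fps_laplace f"
  and borel_add: "fps_borel (f + g) = fps_borel f + fps_borel g"
  and borel_const: "fps_borel (fps_const c * f) = fps_const c * fps_borel f"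
  by (simp_all add: fps_eq_iff fps_laplace_def fps_borel_def ring_distribs add_divide_distrib)

text \<open>The shift turns \<open>(n - 1)!\<close> into \<open>n!\<close>; the extra factor
  \<open>n\<close> is the effect of \<open>t d/dt\<close>.\<close>

lemma laplace_X_mult: "fps_laplace (fps_X * f) = fps_X * fps_deriv (fps_X * fps_laplace f)"
proof (rule fps_ext)
  fix n show "fps_laplace (fps_X * f) $ n = (fps_X * fps_deriv (fps_X * fps_laplace f)) $ n"
    by (cases n) (simp_all add: fps_laplace_def algebra_simps)
qed

lemma mult_compose_nth:
  fixes f v w :: "'a::field fps"
  assumes v: "v $ 0 = 0"
  shows "(w * (f oo v)) $ n = (\<Sum>i\<le>n. f $ i * (w * v ^ i) $ n)"
proof -
  have "(w * (f oo v)) $ n = (\<Sum>j=0..n. w $ j * (\<Sum>i=0..n-j. f $ i * (v ^ i) $ (n - j)))"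
    by (simp add: fps_mult_nth fps_compose_nth)
  \<comment> \<open>\<open>v ^ i\<close> has order at least \<open>i\<close>, so the inner bound may
    be raised to \<open>n\<close>; the two sums are then independent and can be swapped.\<close>
  also have "\<dots> = (\<Sum>j=0..n. w $ j * (\<Sum>i=0..n. f $ i * (v ^ i) $ (n - j)))"
    using startsby_zero_power_prefix[OF v]
    by (intro sum.cong refl arg_cong2[of _ _ _ _ "(*)"] sum.mono_neutral_left) auto
  also have "\<dots> = (\<Sum>i=0..n. f $ i * (\<Sum>j=0..n. w $ j * (v ^ i) $ (n - j)))"
    by (simp add: sum_distrib_left mult_ac) (rule sum.swap)
  finally show ?thesis by (simp add: fps_mult_nth atLeast0AtMost)
qed

lemma geom_fps_mult: "geom_fps a * (1 - fps_const a * fps_X) = 1"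
  unfolding geom_fps_def by (rule inverse_mult_eq_1) simp

lemma geom_fps_moebius: "geom_fps a = 1 + fps_const a * moebius_fps a"
  using geom_fps_mult[of a] by (simp add: moebius_fps_def algebra_simps)

lemma moebius_fps_0 [simp]: "moebius_fps 0 = fps_X"
  by (simp add: moebius_fps_def geom_fps_def)

lemma moebius_fps_nth_0 [simp]: "moebius_fps a $ 0 = 0"
  by (simp add: moebius_fps_def)

text \<open>The series is \<open>t^k / (1 - a t)^(k + 1)\<close>, so this is the negative binomial
  expansion.\<close>

lemma geom_mult_moebius_power_nth:
  assumes "k \<le> n"
  shows "(geom_fps a * moebius_fps a ^ k) $ n = of_nat (n choose k) * a ^ (n - k)"
proof -
  define D where "D = inverse ((1 - fps_const a * fps_X) ^ Suc k)"
  have "geom_fps a * moebius_fps a ^ k = fps_X ^ k * D"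
    by (simp add: D_def moebius_fps_def geom_fps_def power_mult_distrib fps_inverse_power fps_inverse_mult)
  then have "(geom_fps a * moebius_fps a ^ k) $ n = D $ (n - k)"
    using assms by (simp add: fps_X_power_mult_nth)
  also have "D = Abs_fps (\<lambda>i. of_nat ((Suc k + i - 1) choose i) * a ^ i)"
    unfolding D_def by (rule one_minus_const_fps_X_neg_power') simp
  also have "\<dots> $ (n - k) = of_nat (n choose (n - k)) * a ^ (n - k)"
    using assms by simp
  finally show ?thesis using binomial_symmetric[OF assms] by simp
qed

text \<open>The shift rule \<open>s -> s - a\<close> of the Laplace transform, read with
  \<open>t = 1 / s\<close>: then \<open>1 / (s - a)\<close> is \<open>t / (1 - a t)\<close>.
  Formally, \<open>n! / (n - k)!\<close> splits into \<open>k!\<close> and a binomial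
  coefficient.\<close>

lemma laplace_exp_mult:
  "fps_laplace (fps_exp a * f) = geom_fps a * (fps_laplace f oo moebius_fps a)"
proof (rule fps_ext)
  fix n
  have "fps_laplace (fps_exp a * f) $ n = (\<Sum>k\<le>n. fact n * (f $ k * (a ^ (n - k) / fact (n - k))))"
    unfolding fps_laplace_def mult.commute[of "fps_exp a"]
    by (simp add: fps_mult_nth sum_distrib_left atLeast0AtMost)
  also have "\<dots> = (\<Sum>k\<le>n. fps_laplace f $ k * (of_nat (n choose k) * a ^ (n - k)))"
    by (intro sum.cong refl) (simp add: fps_laplace_def binomial_fact field_simps)
  also have "\<dots> = (geom_fps a * (fps_laplace f oo moebius_fps a)) $ n"
    unfolding mult_compose_nth[OF moebius_fps_nth_0]
    by (intro sum.cong refl) (simp add: geom_mult_moebius_power_nth)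
  finally show "fps_laplace (fps_exp a * f) $ n = \<dots>" .
qed

section \<open>Partial fractions in powers of \<open>t / (1 - a t)\<close>\<close>

lemma moebius_mult:
  assumes "a \<noteq> b"
  shows "moebius_fps a * moebius_fps b = fps_const (1 / (a - b)) * (moebius_fps a - moebius_fps b)"
proof -
  define A B c d where "A = geom_fps a" and "B = geom_fps b" and "c = fps_const a" and "d = fps_const b"
  have A: "A * (1 - c * fps_X) = 1" and B: "B * (1 - d * fps_X) = 1"
    by (simp_all add: A_def B_def c_def d_def geom_fps_mult)
  \<comment> \<open>In Laurent series \<open>1 / moebius_fps a = 1 / t - a\<close>, so two such
    reciprocals differ by a constant. Here the denominators are cleared by inserting two factors
    that equal 1.\<close>
  have "fps_X * A - fps_X * B = fps_X * A * (B * (1 - d * fps_X)) - fps_X * B * (A * (1 - c * fps_X))"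
    by (simp add: A B)
  also have "\<dots> = (c - d) * (fps_X * A * (fps_X * B))" by (simp add: algebra_simps)
  also have "c - d = fps_const (a - b)" by (simp add: c_def d_def)
  finally have "fps_X * A - fps_X * B = fps_const (a - b) * (fps_X * A * (fps_X * B))" .
  then have "fps_const (1 / (a - b)) * (fps_X * A - fps_X * B) =
      (fps_const (1 / (a - b)) * fps_const (a - b)) * (fps_X * A * (fps_X * B))"
    by (simp only: mult.assoc)
  then show ?thesis
    using assms by (simp add: A_def B_def moebius_fps_def)
qed

text \<open>The linear span of all powers of all \<open>moebius_fps a\<close>. The value
  \<open>a = 0\<close> contributes the powers of \<open>t\<close>, so polynomials and proper
  fractions are treated alike.\<close>

inductive_set pf_series :: "'a::field_char_0 fps set" where
  pow: "moebius_fps a ^ k \<in> pf_series"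
| add: "f \<in> pf_series \<Longrightarrow> g \<in> pf_series \<Longrightarrow> f + g \<in> pf_series"
| const: "f \<in> pf_series \<Longrightarrow> fps_const c * f \<in> pf_series"

lemma pf_series_diff: "f \<in> pf_series \<Longrightarrow> g \<in> pf_series \<Longrightarrow> f - g \<in> pf_series"
  using pf_series.add[of f "fps_const (-1) * g"] pf_series.const[of g "-1"]
  by (simp del: fps_const_neg add: fps_const_neg[symmetric])

text \<open>Equal parameters raise the exponent; for different ones \<open>moebius_mult\<close>
  trades the mixed product for terms with a smaller exponent of the other factor or with no mixed
  factor at all.\<close>

lemma pf_series_moebius_mult:
  assumes "f \<in> pf_series"
  shows "moebius_fps b * f \<in> pf_series"
  using assms
proof induction
  case (pow a k)
  show ?case
  proof (cases "a = b")
    case True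
    then show ?thesis using pf_series.pow[of a "Suc k"] by simp
  next
    case False
    show ?thesis
    proof (induction k)
      case 0
      then show ?case using pf_series.pow[of b 1] by simp
    next
      case (Suc k)
      have "moebius_fps b * moebius_fps a ^ Suc k = (moebius_fps b * moebius_fps a) * moebius_fps a ^ k"
        by (simp add: mult_ac)
      also have "\<dots> = fps_const (1 / (b - a)) * (moebius_fps b * moebius_fps a ^ k - moebius_fps a ^ Suc k)"
        using False by (subst moebius_mult) (auto simp: left_diff_distrib mult.assoc)
      finally have "moebius_fps b * moebius_fps a ^ Suc k = \<dots>" .
      with Suc pf_series.pow[of a "Suc k"] show ?case
        by (auto intro!: pf_series.const pf_series_diff)
    qed
  qed
next
  case (add f g)
  then show ?case by (simp add: distrib_left pf_series.add)
next
  case (const f c)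
  then show ?case by (simp add: mult.left_commute pf_series.const)
qed

lemma pf_series_poly: "fps_of_poly p \<in> pf_series"
proof (induction p)
  case 0
  show ?case using pf_series.const[OF pf_series.pow[of 0 0], of 0] by simp
next
  case (pCons c p)
  then show ?case
    using pf_series.const[OF pf_series.pow[of 0 0], of c] pf_series_moebius_mult[of "fps_of_poly p" 0]
    by (auto simp: fps_of_poly_pCons mult.commute intro: pf_series.add)
qed

text \<open>The roots of \<open>q\<close> are split off one by one over the complex numbers.
  Dividing by \<open>X - z\<close> means multiplying by \<open>- 1 / z\<close> and
  \<open>geom_fps (1 / z)\<close>, which is \<open>1\<close> plus a multiple of
  \<open>moebius_fps (1 / z)\<close>. The condition at 0 guarantees
  \<open>z \<noteq> 0\<close>.\<close>

lemma pf_series_divide: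
  fixes g :: "complex fps"
  assumes "fps_of_poly q * g \<in> pf_series" and "poly q 0 \<noteq> 0"
  shows "g \<in> pf_series"
  using assms
proof (induction "Polynomial.degree q" arbitrary: q g)
  case 0
  then obtain c where q: "q = [:c:]" "c \<noteq> 0"
    by (auto elim!: degree_eq_zeroE)
  from 0(2) have "fps_const (1 / c) * (fps_const c * g) \<in> pf_series"
    unfolding q by (simp only: fps_of_poly_const pf_series.const)
  also have "fps_const (1 / c) * (fps_const c * g) = g"
    using q(2) by (simp flip: mult.assoc)
  finally show ?case .
next
  case (Suc n)
  then have "\<not> constant (poly q)" by (simp add: constant_degree)
  then obtain z where "poly q z = 0" using fundamental_theorem_of_algebra by blast
  then obtain q' where q: "q = [:- z, 1:] * q'" by (auto simp: poly_eq_0_iff_dvd elim: dvdE)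
  from Suc.prems have z: "z \<noteq> 0" and q'0: "poly q' 0 \<noteq> 0" and "q' \<noteq> 0" by (auto simp: q)
  define h where "h = (fps_X - fps_const z) * g"
  have "Polynomial.degree q = Suc (Polynomial.degree q')"
    unfolding q using \<open>q' \<noteq> 0\<close> by (subst degree_mult_eq) auto
  then have deg: "n = Polynomial.degree q'" using Suc.hyps(2) by simp
  have "fps_of_poly q' * h \<in> pf_series"
    using Suc.prems(1) unfolding q h_def fps_of_poly_mult fps_of_poly_linear
    by (simp add: fps_const_neg [symmetric] mult_ac del: fps_const_neg)
  then have h: "h \<in> pf_series" using Suc.hyps(1)[OF deg] q'0 by blast
  have "geom_fps (1 / z) * h \<in> pf_series"
    unfolding geom_fps_moebius using h
    by (simp add: distrib_right mult.assoc pf_series.add pf_series.const pf_series_moebius_mult)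
  then have "fps_const (- 1 / z) * (geom_fps (1 / z) * h) \<in> pf_series" by (rule pf_series.const)
  also have "fps_const (- 1 / z) * (geom_fps (1 / z) * h) =
      geom_fps (1 / z) * (fps_const (- 1 / z) * (fps_X - fps_const z)) * g"
    by (simp add: h_def mult_ac)
  also have "fps_const (- 1 / z) * (fps_X - fps_const z) = 1 - fps_const (1 / z) * fps_X"
    using z by (simp add: right_diff_distrib fps_const_neg[symmetric] del: fps_const_neg)
  finally show ?case by (simp add: geom_fps_mult)
qed

section \<open>The shuffle product\<close>

definition fps_shuffle :: "'a::field_char_0 fps \<Rightarrow> 'a fps \<Rightarrow> 'a fps" where
  "fps_shuffle f g = fps_laplace (fps_borel f * fps_borel g)"

lemma shuffle_add: "fps_shuffle (f + g) h = fps_shuffle f h + fps_shuffle g h"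
  and shuffle_const: "fps_shuffle (fps_const c * f) h = fps_const c * fps_shuffle f h"
  by (simp_all add: fps_shuffle_def borel_add borel_const laplace_add laplace_const distrib_right mult.assoc)

text \<open>A common argument for rationality and algebraicity, hence the abstract predicate. By
  linearity only powers of \<open>moebius_fps a\<close> matter, and these are reached through the
  series \<open>geom_fps a * moebius_fps a ^ k\<close>, whose Borel transform is
  \<open>t^k exp (a t) / k!\<close>.\<close>

lemma shuffle_closed:
  fixes Q :: "'a::field_char_0 fps \<Rightarrow> bool"
  assumes add: "\<And>f g. Q f \<Longrightarrow> Q g \<Longrightarrow> Q (f + g)"
    and const: "\<And>c f. Q f \<Longrightarrow> Q (fps_const c * f)"
    and X: "\<And>f. Q f \<Longrightarrow> Q (fps_X * f)"
    and deriv: "\<And>f. Q f \<Longrightarrow> Q (fps_deriv f)"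
    and comp: "\<And>a f. Q f \<Longrightarrow> Q (geom_fps a * (f oo moebius_fps a))"
    and f: "f \<in> pf_series" and g: "Q g"
  shows "Q (fps_shuffle f g)"
  using f
proof induction
  case (pow a k)
  have lap: "Q (fps_laplace (fps_X ^ k * fps_borel g))" for k
  proof (induction k)
    case (Suc k)
    have "fps_X ^ Suc k * fps_borel g = fps_X * (fps_X ^ k * fps_borel g)" by simp
    with Suc show ?case by (simp only: laplace_X_mult X deriv)
  qed (simp add: g)
  have base: "fps_shuffle (geom_fps a * moebius_fps a ^ k) g =
      fps_const (1 / fact k) * (geom_fps a * (fps_laplace (fps_X ^ k * fps_borel g) oo moebius_fps a))" for k
  proof -
    have "fps_laplace (fps_exp a * fps_X ^ k) = fps_const (fact k) * (geom_fps a * moebius_fps a ^ k)"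
    proof -
      have "fps_laplace (fps_X ^ k :: 'a fps) = fps_const (fact k) * fps_X ^ k"
        by (simp add: fps_eq_iff fps_laplace_def)
      then show ?thesis
        by (simp add: laplace_exp_mult fps_compose_mult_distrib mult.left_commute flip: fps_compose_power)
    qed
    then have "geom_fps a * moebius_fps a ^ k = fps_const (1 / fact k) * fps_laplace (fps_exp a * fps_X ^ k)"
      by (simp flip: mult.assoc)
    then have "fps_borel (geom_fps a * moebius_fps a ^ k) = fps_const (1 / fact k) * (fps_exp a * fps_X ^ k)"
      by (simp add: borel_const)
    then show ?thesis
      by (simp add: fps_shuffle_def laplace_const mult.assoc flip: laplace_exp_mult)
  qed
  have u: "Q (fps_shuffle (geom_fps a * moebius_fps a ^ k) g)" for k
    unfolding base by (intro const comp lap)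
  show ?case
  \<comment> \<open>For \<open>a = 0\<close> the factor \<open>geom_fps a\<close> is 1 and
    \<open>u\<close> is already the claim. Otherwise
    \<open>geom_fps a = 1 + a * moebius_fps a\<close> can be solved for
    \<open>moebius_fps a\<close>, which gives a recursion in \<open>k\<close>.\<close>
  proof (cases "a = 0")
    case True
    then show ?thesis using u[of k] by (simp add: geom_fps_def)
  next
    case False
    show ?thesis
    proof (induction k)
      case 0
      have "fps_borel 1 = (1 :: 'a fps)" by (simp add: fps_eq_iff fps_borel_def)
      then show ?case using g by (simp add: fps_shuffle_def)
    next
      case (Suc k)
      have "moebius_fps a ^ Suc k = fps_const (1 / a) * (geom_fps a * moebius_fps a ^ k) +
          fps_const (- 1 / a) * moebius_fps a ^ k"
        using False
        by (simp add: geom_fps_moebius distrib_right distrib_left fps_const_neg[symmetric] del: fps_const_neg flip: mult.assoc)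
      then show ?case using Suc u[of k] by (simp only: shuffle_add shuffle_const add const)
    qed
  qed
next
  case (add f h)
  then show ?case by (simp add: shuffle_add assms(1))
next
  case (const f c)
  then show ?case by (simp add: shuffle_const assms(2))
qed

section \<open>Rational and algebraic series\<close>

definition algebraic_elements :: "'a::field set \<Rightarrow> 'a set" where
  "algebraic_elements K = {x. \<exists>P. P \<noteq> 0 \<and> (\<forall>i. poly.coeff P i \<in> K) \<and> poly P x = 0}"

text \<open>\<open>ring.eval\<close> reads a coefficient list from the leading coefficient down,
  \<open>Poly\<close> from the constant term up; hence the \<open>rev\<close>.\<close>

lemma eval_class_ring: "ring.eval (class_ring :: 'a::field ring) l x = poly (Poly (rev l)) x"
proof -
  define R :: "'a ring" where "R = class_ring"
  interpret R: field R unfolding R_def by (rule class_field)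
  have ops: "\<zero>\<^bsub>R\<^esub> = 0" "a \<oplus>\<^bsub>R\<^esub> b = a + b" "a \<otimes>\<^bsub>R\<^esub> b = a * b" "a [^]\<^bsub>R\<^esub> n = a ^ n" for a b and n :: nat
    by (simp_all add: R_def class_ring_simps)
  have "R.eval l x = poly (Poly (rev l)) x"
    by (induction l) (simp_all add: ops Poly_append poly_monom mult.commute)
  then show ?thesis by (simp add: R_def)
qed

lemma class_ring_inverse:
  assumes "x \<noteq> (0 :: 'a::field)"
  shows "inv\<^bsub>class_ring\<^esub> x = inverse x"
proof -
  define R :: "'a ring" where "R = class_ring"
  interpret R: field R unfolding R_def by (rule class_field)
  have "inv\<^bsub>R\<^esub> x = inverse x" using assms by (intro R.comm_inv_char) (auto simp: R_def)
  then show ?thesis by (simp add: R_def)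
qed

lemma subfield_class_ring:
  fixes K :: "'a::field set"
  assumes "1 \<in> K" "\<And>x. x \<in> K \<Longrightarrow> - x \<in> K" "\<And>x. x \<in> K \<Longrightarrow> inverse x \<in> K"
    and "\<And>x y. x \<in> K \<Longrightarrow> y \<in> K \<Longrightarrow> x + y \<in> K" "\<And>x y. x \<in> K \<Longrightarrow> y \<in> K \<Longrightarrow> x * y \<in> K"
  shows "subfield K class_ring"
proof -
  define R :: "'a ring" where "R = class_ring"
  interpret R: field R unfolding R_def by (rule class_field)
  have "subfield K R"
  proof (rule R.subfieldI')
    show "subring K R"
      by (rule R.subringI) (use assms in \<open>auto simp: R_def class_ring_simps\<close>)
    show "inv\<^bsub>R\<^esub> k \<in> K" if "k \<in> K - {\<zero>\<^bsub>R\<^esub>}" for k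
      using that class_ring_inverse[of k] assms(3) by (simp add: R_def)
  qed
  then show ?thesis by (simp add: R_def)
qed

text \<open>The closure properties rest on the fact that the algebraic elements over a subfield form
  a subfield (\<open>R.subfield_of_algebraics\<close>), carried over by the equivalence
  \<open>alg\<close>.\<close>

lemma
  fixes K :: "'a::field set"
  assumes K: "subfield K class_ring"
  shows algebraic_elements_base: "K \<subseteq> algebraic_elements K"
    and algebraic_elements_add: "\<And>x y. x \<in> algebraic_elements K \<Longrightarrow> y \<in> algebraic_elements K \<Longrightarrow> x + y \<in> algebraic_elements K"
    and algebraic_elements_mult: "\<And>x y. x \<in> algebraic_elements K \<Longrightarrow> y \<in> algebraic_elements K \<Longrightarrow> x * y \<in> algebraic_elements K"
    and algebraic_elements_inverse: "\<And>x. x \<in> algebraic_elements K \<Longrightarrow> inverse x \<in> algebraic_elements K"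
proof -
  define R :: "'a ring" where "R = class_ring"
  interpret R: field R unfolding R_def by (rule class_field)
  note [simp] = R_def
  have K': "subfield K R" using K by simp
  have subr: "subring K R" using subfieldE(1)[OF K'] .
  have zero: "0 \<in> K" using subringE(2)[OF subr] by simp
  have eval: "R.eval l x = poly (Poly (rev l)) x" for l x by (simp add: eval_class_ring)
  \<comment> \<open>Annihilating polynomials are translated between the two representations. A
    nonempty list in the carrier has a nonzero head, so the polynomial built from it is not
    zero.\<close>
  have alg: "(R.algebraic over K) x \<longleftrightarrow> x \<in> algebraic_elements K" for x
  proof
    assume "(R.algebraic over K) x"
    then obtain l where l: "l \<in> carrier (K[X]\<^bsub>R\<^esub>)" "l \<noteq> []" "R.eval l x = 0"
      using R.algebraicE[OF subr, of x] by auto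
    then have set: "set l \<subseteq> K" and hd: "hd l \<noteq> 0"
      by (auto simp flip: univ_poly_carrier simp: polynomial_def)
    have "poly.coeff (Poly (rev l)) (length l - 1) \<noteq> 0"
      using l(2) hd by (simp add: coeff_Poly_eq nth_default_def rev_nth hd_conv_nth)
    then have "Poly (rev l) \<noteq> 0" by (metis coeff_0)
    moreover have "poly.coeff (Poly (rev l)) i \<in> K" for i
      using set zero nth_mem[of i "rev l"] by (auto simp: coeff_Poly_eq nth_default_def)
    ultimately show "x \<in> algebraic_elements K"
      using l(3) unfolding algebraic_elements_def eval by blast
  next
    assume "x \<in> algebraic_elements K"
    then obtain P where P: "P \<noteq> 0" "\<And>i. poly.coeff P i \<in> K" "poly P x = 0"
      by (auto simp: algebraic_elements_def)
    define l where "l = rev (coeffs P)"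
    have "l \<noteq> []" using P(1) by (simp add: l_def)
    have "set l \<subseteq> K" using P(2) by (auto simp: l_def coeffs_def)
    moreover have "hd l \<noteq> 0" using P(1) by (simp add: l_def hd_rev last_coeffs_eq_coeff_degree)
    ultimately have "l \<in> carrier (K[X]\<^bsub>R\<^esub>)"
      by (simp flip: univ_poly_carrier add: polynomial_def)
    moreover have "R.eval l x = 0" using P(3) by (simp add: eval l_def del: R_def)
    ultimately show "(R.algebraic over K) x"
      using R.algebraicI \<open>l \<noteq> []\<close> by (auto simp: over_def)
  qed
  have "{x \<in> carrier R. (R.algebraic over K) x} = algebraic_elements K"
    using alg by (auto simp del: R_def) (simp add: R_def)
  then have sub: "subfield (algebraic_elements K) R"
    using R.subfield_of_algebraics[OF K'] by (simp only:)
  then have subr': "subring (algebraic_elements K) R" by (rule subfieldE(1))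
  show "K \<subseteq> algebraic_elements K"
  proof
    fix x assume "x \<in> K"
    then show "x \<in> algebraic_elements K"
      using R.algebraic_self[OF subr, of x] alg[of x] by (auto simp del: R_def)
  qed
  show "x + y \<in> algebraic_elements K" if "x \<in> algebraic_elements K" "y \<in> algebraic_elements K" for x y
    using subringE(7)[OF subr' that] by simp
  show "x * y \<in> algebraic_elements K" if "x \<in> algebraic_elements K" "y \<in> algebraic_elements K" for x y
    using subringE(6)[OF subr' that] by simp
  show "inverse x \<in> algebraic_elements K" if "x \<in> algebraic_elements K" for x
  proof (cases "x = 0")
    case False
    then show ?thesis using R.subfield_m_inv(1)[OF sub, of x] that class_ring_inverse[of x] by simp
  qed (use that in simp)
qed

lemma algebraic_elements_poly:
  fixes K :: "'a::field set"
  assumes K: "subfield K class_ring" and "x \<in> algebraic_elements K"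
    and "\<And>i. poly.coeff P i \<in> K"
  shows "poly P x \<in> algebraic_elements K"
  using assms(3)
proof (induction P)
  case 0
  have "0 \<in> K" using subringE(2)[OF subfieldE(1)[OF K]] by simp
  then show ?case using algebraic_elements_base[OF K] by auto
next
  case (pCons a P)
  have "a \<in> K" and "poly.coeff P i \<in> K" for i
    using pCons.prems[of 0] pCons.prems[of "Suc i"] by (simp_all only: coeff_pCons_0 coeff_pCons_Suc)
  then show ?case
    using pCons.IH algebraic_elements_base[OF K] assms(2)
    by (auto intro!: algebraic_elements_add[OF K] algebraic_elements_mult[OF K])
qed

lemma fls_deriv_poly:
  "fls_deriv (poly P x) = poly (map_poly fls_deriv P) x + poly (pderiv P) x * fls_deriv x"
  for x :: "'a::field_char_0 fls"
  by (induction P) (simp_all add: map_poly_pCons pderiv_pCons algebra_simps)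

text \<open>Differentiating the minimal equation \<open>P(x) = 0\<close> expresses \<open>x'\<close> rationally through \<open>x\<close>.\<close>

lemma algebraic_elements_fls_deriv:
  fixes K :: "'a::field_char_0 fls set"
  assumes K: "subfield K class_ring" and deriv: "\<And>y. y \<in> K \<Longrightarrow> fls_deriv y \<in> K"
    and x: "x \<in> algebraic_elements K"
  shows "fls_deriv x \<in> algebraic_elements K"
proof -
  have zero: "0 \<in> K" and add: "a \<in> K \<Longrightarrow> b \<in> K \<Longrightarrow> a + b \<in> K" for a b
    using subringE(2,7)[OF subfieldE(1)[OF K]] by auto
  define ok where "ok P \<longleftrightarrow> P \<noteq> 0 \<and> (\<forall>i. poly.coeff P i \<in> K) \<and> poly P x = 0" for P
  obtain P where P: "ok P" and min: "\<And>Q. ok Q \<Longrightarrow> Polynomial.degree P \<le> Polynomial.degree Q"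
    using x ex_has_least_nat[of ok _ Polynomial.degree] by (fastforce simp: algebraic_elements_def ok_def)
  have "Polynomial.degree P \<noteq> 0"
  proof
    assume "Polynomial.degree P = 0"
    then obtain a where "P = [:a:]" by (rule degree_eq_zeroE)
    then show False using P by (auto simp add: ok_def)
  qed
  have of_nat: "of_nat n * y \<in> K" if "y \<in> K" for n y
    using that by (induction n) (auto simp: zero add distrib_right)
  have coeff: "poly.coeff (pderiv P) i \<in> K" for i
    using P of_nat[of "poly.coeff P (Suc i)" "Suc i"] by (simp add: coeff_pderiv ok_def)
  \<comment> \<open>Separability: in characteristic 0 the derivative of a nonconstant
    \<open>P\<close> is nonzero and of smaller degree, so a zero at \<open>x\<close> would
    contradict minimality.\<close>
  have "poly (pderiv P) x \<noteq> 0"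
  proof
    assume "poly (pderiv P) x = 0"
    then have "ok (pderiv P)"
      using coeff \<open>Polynomial.degree P \<noteq> 0\<close> by (auto simp: ok_def pderiv_eq_0_iff)
    from min[OF this] show False using \<open>Polynomial.degree P \<noteq> 0\<close> by (simp add: degree_pderiv)
  qed
  moreover have "poly (map_poly fls_deriv P) x + poly (pderiv P) x * fls_deriv x = 0"
    using P fls_deriv_poly[of P x] by (simp add: ok_def)
  ultimately have "fls_deriv x = - (poly (map_poly fls_deriv P) x * inverse (poly (pderiv P) x))"
    by (simp add: field_simps eq_neg_iff_add_eq_0)
  also have "\<dots> = (- 1) * (poly (map_poly fls_deriv P) x * inverse (poly (pderiv P) x))"
    by simp
  also have "\<dots> \<in> algebraic_elements K"
  proof (intro algebraic_elements_mult[OF K] algebraic_elements_inverse[OF K] algebraic_elements_poly[OF K x])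
    have "- 1 \<in> K" using subringE(3,5)[OF subfieldE(1)[OF K]] by (fastforce simp: class_ring_simps)
    then show "- 1 \<in> algebraic_elements K" using algebraic_elements_base[OF K] by blast
    show "poly.coeff (map_poly fls_deriv P) i \<in> K" for i
      using P deriv by (simp add: coeff_map_poly ok_def)
  qed (rule coeff)
  finally show ?thesis .
qed

section \<open>The field of rational functions inside the Laurent series\<close>

lemma fps_of_poly_eq_0_iff: "fps_of_poly q = 0 \<longleftrightarrow> q = 0"
  using fps_of_poly_eq_iff[of q 0] by simp

text \<open>With the denominator cleared, the closure proofs become identities between
  products.\<close>

lemma rational_functions_iff:
  "x \<in> rational_functions \<longleftrightarrow>
     (\<exists>p q. q \<noteq> 0 \<and> fps_to_fls (fps_of_poly q) * x = fps_to_fls (fps_of_poly p))"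
proof -
  have "x = fps_to_fls (fps_of_poly p) / fps_to_fls (fps_of_poly q) \<longleftrightarrow>
      fps_to_fls (fps_of_poly q) * x = fps_to_fls (fps_of_poly p)" if "q \<noteq> 0" for p q :: "complex poly"
    using that by (simp add: fps_of_poly_eq_0_iff nonzero_eq_divide_eq mult.commute)
  then show ?thesis
    unfolding rational_functions_def by blast
qed

lemma rational_functions_poly: "fps_to_fls (fps_of_poly p) \<in> rational_functions"
  unfolding rational_functions_iff by (rule exI[of _ p], rule exI[of _ 1]) simp

lemma rational_functions_X [simp]: "fls_X \<in> rational_functions"
  using rational_functions_poly[of "[:0, 1:]"] by simp

lemma rational_functions_const [simp]: "fls_const c \<in> rational_functions"
  using rational_functions_poly[of "[:c:]"] by (simp add: fps_of_poly_const)

lemma rational_functions_1 [simp]: "1 \<in> rational_functions"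
  using rational_functions_poly[of 1] by simp

lemma rational_functions_add: 
  assumes "x \<in> rational_functions" "y \<in> rational_functions"
  shows "x + y \<in> rational_functions"
proof -
  from assms obtain p q p' q' where *: "q \<noteq> 0" "q' \<noteq> 0"
    "fps_to_fls (fps_of_poly q) * x = fps_to_fls (fps_of_poly p)"
    "fps_to_fls (fps_of_poly q') * y = fps_to_fls (fps_of_poly p')"
    unfolding rational_functions_iff by blast
  have "fps_to_fls (fps_of_poly (q * q')) * (x + y) =
      fps_to_fls (fps_of_poly q') * (fps_to_fls (fps_of_poly q) * x) +
      fps_to_fls (fps_of_poly q) * (fps_to_fls (fps_of_poly q') * y)"
    by (simp add: fps_of_poly_mult fls_times_fps_to_fls algebra_simps)
  also have "\<dots> = fps_to_fls (fps_of_poly (q' * p + q * p'))"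
    by (simp add: * fps_of_poly_mult fps_of_poly_add fls_times_fps_to_fls)
  finally show ?thesis unfolding rational_functions_iff using * by (metis mult_eq_0_iff)
qed

lemma rational_functions_mult: 
  assumes "x \<in> rational_functions" "y \<in> rational_functions"
  shows "x * y \<in> rational_functions"
proof -
  from assms obtain p q p' q' where *: "q \<noteq> 0" "q' \<noteq> 0"
    "fps_to_fls (fps_of_poly q) * x = fps_to_fls (fps_of_poly p)"
    "fps_to_fls (fps_of_poly q') * y = fps_to_fls (fps_of_poly p')"
    unfolding rational_functions_iff by blast
  have "fps_to_fls (fps_of_poly (q * q')) * (x * y) =
      (fps_to_fls (fps_of_poly q) * x) * (fps_to_fls (fps_of_poly q') * y)"
    by (simp add: fps_of_poly_mult fls_times_fps_to_fls)
  also have "\<dots> = fps_to_fls (fps_of_poly (p * p'))"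
    by (simp add: * fps_of_poly_mult fls_times_fps_to_fls)
  finally show ?thesis unfolding rational_functions_iff using * by (metis mult_eq_0_iff)
qed

lemma rational_functions_uminus: "x \<in> rational_functions \<Longrightarrow> - x \<in> rational_functions"
  using rational_functions_mult[OF rational_functions_const[of "- 1"], of x]
  by (metis fls_const_1 fls_const_uminus mult_minus1)

lemma rational_functions_inverse: "x \<in> rational_functions \<Longrightarrow> inverse x \<in> rational_functions"
proof (cases "x = 0")
  case False
  assume "x \<in> rational_functions"
  then obtain p q where *: "q \<noteq> 0" "fps_to_fls (fps_of_poly q) * x = fps_to_fls (fps_of_poly p)"
    unfolding rational_functions_iff by blast
  have "p \<noteq> 0"
    using * False by (auto simp: fps_of_poly_eq_0_iff)
  moreover have "fps_to_fls (fps_of_poly p) * inverse x = fps_to_fls (fps_of_poly q)"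
    using False by (simp flip: *(2))
  ultimately show ?thesis unfolding rational_functions_iff by blast
qed simp

lemma subfield_rational_functions: "subfield rational_functions class_ring"
  by (rule subfield_class_ring)
    (simp_all add: rational_functions_add rational_functions_mult rational_functions_uminus
      rational_functions_inverse)

lemma rational_functions_deriv:
  assumes "x \<in> rational_functions"
  shows "fls_deriv x \<in> rational_functions"
proof -
  from assms obtain p q where *: "q \<noteq> 0" "fps_to_fls (fps_of_poly q) * x = fps_to_fls (fps_of_poly p)"
    unfolding rational_functions_iff by blast
  let ?q = "fps_to_fls (fps_of_poly q)"
  have q0: "?q \<noteq> 0" using *(1) by (simp add: fps_of_poly_eq_0_iff)
  have "fls_deriv (?q * x) = fls_deriv (fps_to_fls (fps_of_poly p))" by (simp only: *)
  then have "?q * fls_deriv x = fps_to_fls (fps_of_poly (pderiv p)) + - (fps_to_fls (fps_of_poly (pderiv q)) * x)"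
    by (simp add: fls_deriv_fps_to_fls fps_of_poly_pderiv algebra_simps)
  then have "fls_deriv x = inverse ?q *
     (fps_to_fls (fps_of_poly (pderiv p)) + - (fps_to_fls (fps_of_poly (pderiv q)) * x))"
    using q0 by (simp add: field_simps)
  then show ?thesis
    using assms by (simp only:) (intro rational_functions_mult rational_functions_add rational_functions_uminus
      rational_functions_inverse rational_functions_poly assms)
qed

lemma rational_functions_geom: "fps_to_fls (geom_fps a) \<in> rational_functions"
proof -
  have "fps_to_fls (fps_of_poly [:1, - a:]) * fps_to_fls (geom_fps a) = fps_to_fls (fps_of_poly 1)"
    using geom_fps_mult[of a] unfolding fls_times_fps_to_fls [symmetric] fps_of_poly_linear'
    by (simp add: fps_const_neg [symmetric] mult.commute del: fps_const_neg)
  then show ?thesis unfolding rational_functions_iff by (metis one_neq_zero pCons_eq_0_iff)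
qed

lemma rational_functions_moebius: "fps_to_fls (moebius_fps a) \<in> rational_functions"
  by (simp add: moebius_fps_def fls_times_fps_to_fls rational_functions_mult rational_functions_geom)

lemma moebius_fps_nonzero: "moebius_fps a \<noteq> 0"
  using geom_fps_mult[of a] by (auto simp: moebius_fps_def)

lemma rational_functions_compose:
  assumes "x \<in> rational_functions"
  shows "fls_compose_fps x (moebius_fps a) \<in> rational_functions"
proof -
  have poly: "fls_compose_fps (fps_to_fls (fps_of_poly p)) (moebius_fps a) \<in> rational_functions" for p
  proof (induction p)
    case 0
    then show ?case using rational_functions_const[of 0] by simp
  next
    case (pCons c p)
    then show ?case
      by (simp add: fps_of_poly_pCons fls_times_fps_to_fls fls_compose_fps_add fls_compose_fps_mult
          moebius_fps_nonzero rational_functions_add rational_functions_mult rational_functions_moebius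
          del: fls_compose_fps_to_fls)
  qed
  from assms obtain p q where "x = fps_to_fls (fps_of_poly p) / fps_to_fls (fps_of_poly q)"
    unfolding rational_functions_def by blast
  then show ?thesis
    using poly[of p] rational_functions_inverse[OF poly[of q]]
    by (simp add: fls_compose_fps_divide moebius_fps_nonzero rational_functions_mult
        divide_inverse[of "fls_compose_fps _ _"] del: fls_compose_fps_to_fls)
qed

text \<open>Substituting \<open>t / (1 - a t)\<close> is an injective homomorphism of Laurent series
  that preserves rational functions. Applied to the coefficients of an annihilating polynomial of
  \<open>x\<close>, it yields a nonzero one for the image of \<open>x\<close>.\<close>

lemma algebraic_compose:
  assumes "x \<in> algebraic_elements rational_functions"
  shows "fls_compose_fps x (moebius_fps a) \<in> algebraic_elements rational_functions"
proof -
  let ?c = "\<lambda>x. fls_compose_fps x (moebius_fps a)"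
  from assms obtain P where P: "P \<noteq> 0" "\<And>i. poly.coeff P i \<in> rational_functions" "poly P x = 0"
    by (auto simp: algebraic_elements_def)
  have "?c (poly P x) = poly (map_poly ?c P) (?c x)"
    by (induction P) (simp_all add: map_poly_pCons fls_compose_fps_add fls_compose_fps_mult moebius_fps_nonzero)
  moreover have "map_poly ?c P \<noteq> 0"
    using P(1) by (simp add: map_poly_eq_0_iff fls_compose_fps_eq_0_iff moebius_fps_nonzero)
  moreover have "poly.coeff (map_poly ?c P) i \<in> rational_functions" for i
    using P(2) by (simp add: coeff_map_poly rational_functions_compose)
  ultimately show ?thesis using P(3) unfolding algebraic_elements_def by auto
qed

section \<open>Rational and algebraic power series, and their closure under shuffling\<close>

lemma algebraic_series_iff: "algebraic_series f \<longleftrightarrow> fps_to_fls f \<in> algebraic_elements rational_functions"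
  by (simp add: algebraic_series_def algebraic_elements_def)

lemma rational_imp_algebraic_series: "rational_series f \<Longrightarrow> algebraic_series f"
  using algebraic_elements_base[OF subfield_rational_functions]
  by (auto simp: algebraic_series_iff rational_series_def)

text \<open>\<open>pf_series_divide\<close> wants a denominator that does not vanish at 0. If
  \<open>t\<close> divides \<open>q\<close>, then it also divides \<open>p\<close>, since
  \<open>f\<close> has no pole at 0, and the common factor cancels.\<close>

lemma rational_series_pf:
  assumes "rational_series f"
  shows "f \<in> pf_series"
proof -
  have *: "f \<in> pf_series" if "q \<noteq> 0" "fps_of_poly q * f = fps_of_poly p" for p q
    using that
  proof (induction "Polynomial.degree q" arbitrary: p q rule: less_induct)
    case less
    show ?case
    proof (cases "poly q 0 = 0")
      case False
      then show ?thesis using less pf_series_divide[of q f] pf_series_poly[of p] by simp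
    next
      case True
      then obtain q' where q: "q = [:0, 1:] * q'" by (auto simp: poly_eq_0_iff_dvd elim: dvdE)
      have "fps_of_poly p $ 0 = 0"
        using True by (simp flip: less.prems(2) add: poly_0_coeff_0)
      then have "poly p 0 = 0" by (simp add: poly_0_coeff_0)
      then obtain p' where p: "p = [:0, 1:] * p'" by (auto simp: poly_eq_0_iff_dvd elim: dvdE)
      have "fps_X * (fps_of_poly q' * f) = fps_X * fps_of_poly p'"
        using less.prems(2) by (simp only: p q fps_of_poly_mult fps_of_poly_fps_X mult.assoc)
      then have eq: "fps_of_poly q' * f = fps_of_poly p'" by simp
      have "q' \<noteq> 0" using less.prems(1) by (auto simp: q)
      then have "Polynomial.degree q' < Polynomial.degree q"
        unfolding q by (subst degree_mult_eq) auto
      then show ?thesis using less.hyps \<open>q' \<noteq> 0\<close> eq by blast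
    qed
  qed
  from assms obtain p q where "q \<noteq> 0"
      "fps_to_fls (fps_of_poly q * f) = fps_to_fls (fps_of_poly p)"
    unfolding rational_series_def rational_functions_iff by (auto simp: fls_times_fps_to_fls)
  then show ?thesis using * by (simp only: fps_to_fls_eq_iff)
qed

lemma
  shows rational_series_add: "rational_series f \<Longrightarrow> rational_series g \<Longrightarrow> rational_series (f + g)"
    and rational_series_mult: "rational_series f \<Longrightarrow> rational_series g \<Longrightarrow> rational_series (f * g)"
    and rational_series_const: "rational_series (fps_const c)"
    and rational_series_X: "rational_series fps_X"
    and rational_series_geom: "rational_series (geom_fps a)"
    and rational_series_deriv: "rational_series f \<Longrightarrow> rational_series (fps_deriv f)"
    and rational_series_compose: "rational_series f \<Longrightarrow> rational_series (f oo moebius_fps a)"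
  using rational_functions_deriv[of "fps_to_fls f"] rational_functions_compose[of "fps_to_fls f" a]
  by (simp_all add: rational_series_def rational_functions_add rational_functions_mult
      fls_times_fps_to_fls fls_deriv_fps_to_fls rational_functions_geom moebius_fps_nonzero)

lemma
  shows algebraic_series_add: "algebraic_series f \<Longrightarrow> algebraic_series g \<Longrightarrow> algebraic_series (f + g)"
    and algebraic_series_mult: "algebraic_series f \<Longrightarrow> algebraic_series g \<Longrightarrow> algebraic_series (f * g)"
    and algebraic_series_deriv: "algebraic_series f \<Longrightarrow> algebraic_series (fps_deriv f)"
    and algebraic_series_compose: "algebraic_series f \<Longrightarrow> algebraic_series (f oo moebius_fps a)"
  using algebraic_elements_fls_deriv[OF subfield_rational_functions rational_functions_deriv, of "fps_to_fls f"]
    algebraic_compose[of "fps_to_fls f" a]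
  by (simp_all add: algebraic_series_iff fls_times_fps_to_fls fls_deriv_fps_to_fls moebius_fps_nonzero
      algebraic_elements_add[OF subfield_rational_functions]
      algebraic_elements_mult[OF subfield_rational_functions])

lemma rational_series_shuffle:
  assumes "rational_series f" "rational_series g"
  shows "rational_series (fps_shuffle f g)"
  using rational_series_pf[OF assms(1)] assms(2)
  by (rule shuffle_closed[where Q = rational_series, rotated 5])
    (simp_all add: rational_series_add rational_series_mult rational_series_const rational_series_X
      rational_series_geom rational_series_deriv rational_series_compose)

lemma algebraic_series_shuffle:
  assumes "rational_series f" "algebraic_series g"
  shows "algebraic_series (fps_shuffle f g)"
  using rational_series_pf[OF assms(1)] assms(2)
  by (rule shuffle_closed[where Q = algebraic_series, rotated 5])
    (simp_all add: algebraic_series_add algebraic_series_mult algebraic_series_deriv algebraic_series_compose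
      rational_imp_algebraic_series rational_series_const rational_series_X rational_series_geom)

section \<open>Dimensions of quotient spaces\<close>

context vector_space
begin

lemma span_Int_span_trivial:
  assumes ind: "independent (A \<union> B)" and fin: "finite A" "finite B" and disj: "A \<inter> B = {}"
    and x: "x \<in> span A" "x \<in> span B"
  shows "x = 0"
proof -
  obtain a where a: "x = (\<Sum>v\<in>A. scale (a v) v)"
    using x(1) span_finite[OF fin(1)] by auto
  obtain b where b: "x = (\<Sum>v\<in>B. scale (b v) v)"
    using x(2) span_finite[OF fin(2)] by auto
  define c where "c v = (if v \<in> A then a v else - b v)" for v
  have cB: "c v = - b v" if "v \<in> B" for v using disj that by (auto simp: c_def)
  have "(\<Sum>v\<in>A \<union> B. scale (c v) v) = (\<Sum>v\<in>A. scale (a v) v) + (\<Sum>v\<in>B. scale (- b v) v)"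
    unfolding sum.union_disjoint[OF fin disj]
    by (intro arg_cong2[of _ _ _ _ "(+)"] sum.cong refl) (simp_all add: cB, simp add: c_def)
  also have "\<dots> = 0" using a b by (simp add: sum_negf)
  finally have "c v = 0" if "v \<in> A" for v
    using independentD[OF ind, of "A \<union> B" c v] fin that by blast
  then have "a v = 0" if "v \<in> A" for v using that by (auto simp: c_def)
  then show ?thesis by (simp add: a)
qed

lemma finite_basis_exists:
  assumes "finite S" "V \<subseteq> span S"
  obtains B where "B \<subseteq> V" "independent B" "V \<subseteq> span B" "finite B" "card B = dim V"
proof -
  obtain B where B: "B \<subseteq> V" "independent B" "V \<subseteq> span B" "card B = dim V"
    using basis_exists by blast
  then have "finite B" using independent_span_bound[OF assms(1), of B] assms(2) by blast
  then show thesis using B that by blast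
qed

lemma independent_card_le_dim_finite:
  assumes "finite S" "V \<subseteq> span S" and "independent B" "B \<subseteq> V"
  shows "card B \<le> dim V"
proof -
  obtain C where C: "V \<subseteq> span C" "finite C" "card C = dim V"
    using finite_basis_exists[OF assms(1,2)] by metis
  then show ?thesis using independent_span_bound[OF C(2) assms(3)] assms(4) by auto
qed

text \<open>A basis of \<open>U\<close> is extended to one of \<open>V\<close>, and \<open>G\<close>
  consists of the added vectors. This serves both for quotient dimensions and for choosing
  generators of an ideal.\<close>

lemma complement_basis_exists:
  assumes V: "subspace V" and U: "subspace U" and "U \<subseteq> V" and S: "finite S" "V \<subseteq> span S"
  obtains G where "G \<subseteq> V" "independent G" "finite G"
    "\<And>v. v \<in> V \<Longrightarrow> \<exists>g\<in>span G. v - g \<in> U" "span G \<inter> U \<subseteq> {0}" "card G + dim U = dim V"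
proof -
  obtain C where C: "C \<subseteq> U" "independent C" "U \<subseteq> span C" "finite C" "card C = dim U"
    using finite_basis_exists[of S U] assms by blast
  have "C \<subseteq> V" using C(1) \<open>U \<subseteq> V\<close> by blast
  then obtain D where D: "C \<subseteq> D" "D \<subseteq> V" "independent D" "V \<subseteq> span D"
    using maximal_independent_subset_extend[OF _ C(2), of V] by metis
  have finD: "finite D" using independent_span_bound[OF S(1) D(3)] D(2) S(2) by blast
  have CU: "span C \<subseteq> U" using span_minimal[OF C(1) U] .
  have DCG: "D = (D - C) \<union> C" using D(1) by blast
  show thesis
  proof (rule that[of "D - C"])
    show "D - C \<subseteq> V" using D(2) by blast
    show "independent (D - C)" using D(3) independent_mono by blast
    show "finite (D - C)" using finD by simp
    show "\<exists>g\<in>span (D - C). v - g \<in> U" if "v \<in> V" for v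
    proof -
      have "v \<in> span ((D - C) \<union> C)" using that D(4) DCG by auto
      then obtain g c where "v = g + c" "g \<in> span (D - C)" "c \<in> span C"
        unfolding span_Un by blast
      then show ?thesis using CU by (intro bexI[of _ g]) auto
    qed
    show "span (D - C) \<inter> U \<subseteq> {0}"
      using span_Int_span_trivial[of "D - C" C] D(3) DCG finD C(3,4) by auto
    have "dim V = card D" using basis_card_eq_dim[OF D(2,4,3)] by simp
    then show "card (D - C) + dim U = dim V"
      using D(1) finD C(4,5) card_mono[OF finD D(1)] by (simp add: card_Diff_subset)
  qed
qed

text \<open>Independence of the indexed family already forces \<open>v\<close> to be injective: for
  two equal members, the coefficients 1 and -1 give a relation. Products of basis elements can thus
  be counted by their indices without first being shown distinct.\<close>

lemma dim_eq_card_family: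
  assumes fin: "finite I" and V: "\<And>i. i \<in> I \<Longrightarrow> v i \<in> V" "V \<subseteq> span (v ` I)"
    and ind: "\<And>c. (\<Sum>i\<in>I. scale (c i) (v i)) = 0 \<Longrightarrow> \<forall>i\<in>I. c i = 0"
  shows "dim V = card I"
proof -
  have inj: "inj_on v I"
  proof (rule inj_onI, rule ccontr)
    fix i j assume ij: "i \<in> I" "j \<in> I" "v i = v j" "i \<noteq> j"
    define c where "c k = (if k = i then 1 else if k = j then - 1 else 0 :: 'a)" for k
    have "(\<Sum>k\<in>I. scale (c k) (v k)) = (\<Sum>k\<in>{i, j}. scale (c k) (v k))"
      using fin ij by (intro sum.mono_neutral_right) (auto simp: c_def)
    also have "\<dots> = 0" using ij by (simp add: c_def)
    finally show False using ind[of c] ij(1) by (auto simp: c_def)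
  qed
  have "independent (v ` I)"
  proof (rule independent_if_scalars_zero)
    fix f x assume "(\<Sum>x\<in>v ` I. scale (f x) x) = 0" and x: "x \<in> v ` I"
    then have "(\<Sum>i\<in>I. scale (f (v i)) (v i)) = 0" by (simp add: sum.reindex[OF inj])
    with ind[of "f \<circ> v"] x show "f x = 0" by auto
  qed (use fin in simp)
  then have "card (v ` I) = dim V" using V by (intro basis_card_eq_dim) auto
  then show ?thesis by (simp add: card_image[OF inj])
qed

text \<open>The cosets of a complement basis form a basis of the quotient. This ties the
  carrier-based dimension in the definition of codimensions to \<open>dim\<close>.\<close>

lemma dim_quotient_space:
  assumes V: "subspace V" and U: "subspace U" and UV: "U \<subseteq> V" and S: "finite S" "V \<subseteq> span S"
  shows "vectorspace.dim class_ring (quotient_space scale V U) + dim U = dim V"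
proof -
  define Q where "Q = quotient_space scale V U"
  interpret Q: vectorspace class_ring Q
    unfolding Q_def by (rule vectorspace_quotient_space[OF vector_space_axioms V U UV])
  define C where "C v = (\<lambda>u. v + u) ` U" for v
  have mem: "x \<in> C v \<longleftrightarrow> x - v \<in> U" for x v
    unfolding C_def by (auto simp: image_iff intro!: bexI[of _ "x - v"])
  have C_eq: "C v = C w \<longleftrightarrow> v - w \<in> U" for v w
  proof
    assume "C v = C w"
    then show "v - w \<in> U" using mem[of v v] mem[of v w] subspace_0[OF U] by simp
  next
    assume vw: "v - w \<in> U"
    have "x - v \<in> U \<longleftrightarrow> x - w \<in> U" for x
      using subspace_add[OF U _ vw, of "x - v"] subspace_diff[OF U _ vw, of "x - w"] by auto
    then show "C v = C w" by (auto simp: mem)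
  qed
  have carrier: "carrier Q = C ` V" and zero: "\<zero>\<^bsub>Q\<^esub> = C 0"
    by (simp_all add: Q_def quotient_space_def C_def)
  have add: "C v \<oplus>\<^bsub>Q\<^esub> C w = C (v + w)" for v w
  proof -
    have "\<exists>a b. x = a + b \<and> a \<in> C v \<and> b \<in> C w" if "x \<in> C (v + w)" for x
      by (rule exI[of _ "x - w"], rule exI[of _ w])
        (use that U in \<open>simp add: mem subspace_0 algebra_simps\<close>)
    moreover have "a + b \<in> C (v + w)" if "a \<in> C v" "b \<in> C w" for a b
      using subspace_add[OF U, of "a - v" "b - w"] that by (simp add: mem algebra_simps)
    ultimately show ?thesis by (auto simp: Q_def quotient_space_def)
  qed
  have smult: "c \<odot>\<^bsub>Q\<^esub> C v = C (scale c v)" for c v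
  proof -
    have "\<exists>a u. x = scale c a + u \<and> a \<in> C v \<and> u \<in> U" if "x \<in> C (scale c v)" for x
      by (rule exI[of _ v], rule exI[of _ "x - scale c v"])
        (use that U in \<open>simp add: mem subspace_0\<close>)
    moreover have "scale c a + u \<in> C (scale c v)" if "a \<in> C v" "u \<in> U" for a u
      using subspace_add[OF U subspace_scale[OF U, of "a - v" c], of u] that
      by (simp add: mem algebra_simps)
    ultimately show ?thesis by (auto simp: Q_def quotient_space_def)
  qed
  obtain G where G: "G \<subseteq> V" "independent G" "finite G"
    "\<And>v. v \<in> V \<Longrightarrow> \<exists>g\<in>span G. v - g \<in> U" "span G \<inter> U \<subseteq> {0}" "card G + dim U = dim V"
    using complement_basis_exists[OF V U UV S] by metis
  have inj: "inj_on C G"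
  proof (rule inj_onI)
    fix g h assume gh: "g \<in> G" "h \<in> G" "C g = C h"
    then have "g - h \<in> span G \<inter> U" by (auto simp: C_eq intro: span_diff span_base)
    then show "g = h" using G(5) by auto
  qed
  have CG: "C ` G \<subseteq> carrier Q" using G(1) by (auto simp: carrier)
  have lincomb: "Q.lincomb a (C ` H) = C (\<Sum>g\<in>H. scale (a (C g)) g)" if "H \<subseteq> G" for a H
  proof -
    have "finite H" using that G(3) finite_subset by blast
    then show ?thesis using that
    proof induction
      case empty
      then show ?case by (simp add: Q.lincomb_def zero)
    next
      case (insert g H)
      have notin: "C g \<notin> C ` H" using insert.hyps insert.prems inj by (auto dest: inj_onD)
      have CH: "C ` H \<subseteq> carrier Q" using insert.prems CG by blast
      have scal: "a (C h) \<odot>\<^bsub>Q\<^esub> C h \<in> carrier Q" if "h \<in> insert g H" for h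
        using that insert.prems G(1) subspace_scale[OF V] by (auto simp: smult carrier)
      have "Q.lincomb a (C ` insert g H) = a (C g) \<odot>\<^bsub>Q\<^esub> C g \<oplus>\<^bsub>Q\<^esub> Q.lincomb a (C ` H)"
        unfolding Q.lincomb_def image_insert using notin insert.hyps(1) scal
        by (intro Q.M.finsum_insert) auto
      then show ?case using insert by (simp add: smult add)
    qed
  qed
  have "Q.basis (C ` G)"
    unfolding Q.basis_def
  proof (intro conjI CG)
    show "Q.lin_indpt (C ` G)"
    proof (rule Q.finite_lin_indpt2)
      fix a assume "Q.lincomb a (C ` G) = \<zero>\<^bsub>Q\<^esub>"
      then have "(\<Sum>g\<in>G. scale (a (C g)) g) \<in> U" by (simp add: lincomb zero C_eq)
      moreover have "(\<Sum>g\<in>G. scale (a (C g)) g) \<in> span G"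
        by (intro span_sum span_scale span_base)
      ultimately have "(\<Sum>g\<in>G. scale (a (C g)) g) = 0" using G(5) by blast
      then show "\<forall>v\<in>C ` G. a v = \<zero>\<^bsub>class_ring\<^esub>"
        using independentD[OF G(2) G(3) order.refl, of "\<lambda>g. a (C g)"] by auto
    qed (use G(3) CG in auto)
    show "Q.span (C ` G) = carrier Q"
    proof
      show "Q.span (C ` G) \<subseteq> carrier Q" using Q.span_is_subset2[OF CG] .
      show "carrier Q \<subseteq> Q.span (C ` G)"
      proof
        fix x assume "x \<in> carrier Q"
        then obtain v where v: "v \<in> V" "x = C v" by (auto simp: carrier)
        from G(4)[OF v(1)] obtain g where "g \<in> span G" "v - g \<in> U" by blast
        then obtain c where "x = C (\<Sum>g\<in>G. scale (c g) g)"
          using v(2) span_finite[OF G(3)] by (auto simp: C_eq)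
        \<comment> \<open>Coefficients in the quotient are indexed by cosets, so each coset is
          traced back to its unique representative in \<open>G\<close>.\<close>
        also have "\<dots> = Q.lincomb (\<lambda>A. c (the_inv_into G C A)) (C ` G)"
          by (simp add: lincomb the_inv_into_f_f[OF inj] cong: sum.cong)
        finally show "x \<in> Q.span (C ` G)"
          using G(3) by (auto simp: Q.span_def)
      qed
    qed
  qed
  then have "Q.dim = card G" using Q.dim_basis[of "C ` G"] G(3) by (simp add: card_image[OF inj])
  then show ?thesis using G(6) by (simp add: Q_def)
qed

end

section \<open>Coefficients of words\<close>

abbreviation wcoeff :: "'k::zero free_alg \<Rightarrow> nat list \<Rightarrow> 'k" where
  "wcoeff \<equiv> Poly_Mapping.lookup"

abbreviation word :: "nat list \<Rightarrow> 'k::field free_alg" where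
  "word w \<equiv> Poly_Mapping.single w 1"

text \<open>Strips a leading letter \<open>b\<close> and drops all words that do not begin with
  \<open>b\<close>; also known as the left or Brzozowski derivative of a series.\<close>

definition left_quotient :: "nat \<Rightarrow> 'k::field free_alg \<Rightarrow> 'k free_alg" where
  "left_quotient b = Poly_Mapping.map_key (Cons b)"

text \<open>A pullback on coefficients: for bijective \<open>s\<close>, a word \<open>u\<close>
  occurring in \<open>f\<close> turns into its image under the inverse of \<open>s\<close>.\<close>

definition rename_letters :: "(nat \<Rightarrow> nat) \<Rightarrow> 'k::field free_alg \<Rightarrow> 'k free_alg" where
  "rename_letters s = Poly_Mapping.map_key (map s)"

definition keep_words :: "nat list set \<Rightarrow> 'k::field free_alg \<Rightarrow> 'k free_alg" where
  "keep_words S = Poly_Mapping.mapp (\<lambda>w a. if w \<in> S then a else 0)"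

definition multilinear_on :: "nat set \<Rightarrow> 'k::field free_alg set" where
  "multilinear_on A = {f. Poly_Mapping.keys f \<subseteq> permutations_of_set A}"

abbreviation multilinear_part :: "nat set \<Rightarrow> 'k::field free_alg \<Rightarrow> 'k free_alg" where
  "multilinear_part A \<equiv> keep_words (permutations_of_set A)"

lemma wcoeff_left_quotient [simp]: "wcoeff (left_quotient b f) w = wcoeff f (b # w)"
  by (simp add: left_quotient_def Poly_Mapping.map_key.rep_eq inj_def)

lemma wcoeff_rename_letters [simp]:
  "inj s \<Longrightarrow> wcoeff (rename_letters s f) w = wcoeff f (map s w)"
  by (simp add: rename_letters_def Poly_Mapping.map_key.rep_eq)

lemma wcoeff_keep_words [simp]: "wcoeff (keep_words S f) w = (if w \<in> S then wcoeff f w else 0)"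
  by (auto simp: keep_words_def Poly_Mapping.lookup_mapp "when_def" in_keys_iff)

lemma multilinear_on_iff: "f \<in> multilinear_on A \<longleftrightarrow> (\<forall>w. w \<notin> permutations_of_set A \<longrightarrow> wcoeff f w = 0)"
  by (auto simp: multilinear_on_def in_keys_iff)

text \<open>A word factors into two words exactly by choosing a cutting position, so the convolution
  is a finite sum over prefix lengths.\<close>

lemma wcoeff_mult:
  "wcoeff (f * g) w = (\<Sum>i\<le>length w. wcoeff f (take i w) * wcoeff g (drop i w))"
proof -
  define h where "h u = wcoeff f u * (\<Sum>v. wcoeff g v when w = u + v)" for u
  have prefix: "h (take i w) = wcoeff f (take i w) * wcoeff g (drop i w)" for i
  proof -
    have "w = take i w + v \<longleftrightarrow> v = drop i w" for v
      by (metis append_take_drop_id plus_list_def same_append_eq)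
    then show ?thesis by (simp add: h_def)
  qed
  have "wcoeff (f * g) w = Sum_any h"
    by (simp add: Poly_Mapping.lookup_mult h_def)
  also have "\<dots> = sum h ((\<lambda>i. take i w) ` {..length w})"
  proof (rule Sum_any.expand_superset)
    show "{u. h u \<noteq> 0} \<subseteq> (\<lambda>i. take i w) ` {..length w}"
    proof
      fix u assume "u \<in> {u. h u \<noteq> 0}"
      then obtain v where "w = u + v"
        by (cases "\<exists>v. w = u + v") (auto simp: h_def)
      then have "u = take (length u) w" "length u \<le> length w" by (simp_all add: plus_list_def)
      then show "u \<in> (\<lambda>i. take i w) ` {..length w}" by blast
    qed
  qed simp
  also have "\<dots> = (\<Sum>i\<le>length w. h (take i w))"
    by (rule sum.reindex_cong[where l = "\<lambda>i. take i w"])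
      (auto simp: inj_on_def dest: arg_cong[where f = length])
  finally show ?thesis by (simp add: prefix)
qed

lemma wcoeff_word_mult:
  "wcoeff (word u * f) w = (if take (length u) w = u then wcoeff f (drop (length u) w) else 0)"
proof (cases "take (length u) w = u")
  case True
  then have le: "length u \<le> length w" by (metis length_take min.cobounded1 min_def)
  have "wcoeff (word u * f) w = (\<Sum>i\<in>{length u}. wcoeff (word u) (take i w) * wcoeff f (drop i w))"
    unfolding wcoeff_mult using le
    by (intro sum.mono_neutral_right) (auto simp: Poly_Mapping.lookup_single "when_def")
  with True show ?thesis by simp
next
  case False
  then have "wcoeff (word u) (take i w) = (0 :: 'a)" if "i \<le> length w" for i
    using that by (auto simp: Poly_Mapping.lookup_single "when_def")
  then show ?thesis using False by (simp add: wcoeff_mult)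
qed

lemma free_scale_mult_left: "free_scale c f * g = free_scale c (f * g)"
  and free_scale_mult_right: "f * free_scale c g = free_scale c (f * g)"
  by (rule poly_mapping_eqI; simp add: wcoeff_mult lookup_free_scale sum_distrib_left mult_ac)+

lemma word_expansion:
  assumes "finite S" "Poly_Mapping.keys f \<subseteq> S"
  shows "f = (\<Sum>w\<in>S. free_scale (wcoeff f w) (word w))"
proof (rule poly_mapping_eqI)
  fix u
  have "(\<Sum>w\<in>S. wcoeff (free_scale (wcoeff f w) (word w)) u) = (\<Sum>w\<in>S. if w = u then wcoeff f u else 0)"
    by (intro sum.cong refl) (auto simp: lookup_free_scale Poly_Mapping.lookup_single "when_def")
  also have "\<dots> = wcoeff f u" using assms by (auto simp: in_keys_iff sum.delta)
  finally show "wcoeff f u = wcoeff (\<Sum>w\<in>S. free_scale (wcoeff f w) (word w)) u"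
    by (simp add: Poly_Mapping.lookup_sum)
qed

lemma word_mult: "word u * word v = word (u @ v)"
  by (simp add: Poly_Mapping.mult_single plus_list_def)

section \<open>Multilinear polynomials in a finite set of letters\<close>

lemma subspace_multilinear_on: "free_alg.subspace (multilinear_on A)"
  by (auto simp: free_alg.subspace_def multilinear_on_iff Poly_Mapping.lookup_add lookup_free_scale)

lemma multilinear_on_eq_span: "multilinear_on A = free_alg.span (word ` permutations_of_set A)"
proof
  show "multilinear_on A \<subseteq> free_alg.span (word ` permutations_of_set A)"
  proof
    fix f :: "'k::field free_alg" assume "f \<in> multilinear_on A"
    then have "f = (\<Sum>w\<in>permutations_of_set A. free_scale (wcoeff f w) (word w))"
      by (intro word_expansion) (auto simp: multilinear_on_def)
    also have "\<dots> \<in> free_alg.span (word ` permutations_of_set A)"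
      by (intro free_alg.span_sum free_alg.span_scale free_alg.span_base imageI)
    finally show "f \<in> free_alg.span (word ` permutations_of_set A)" .
  qed
  show "free_alg.span (word ` permutations_of_set A) \<subseteq> multilinear_on A"
    by (rule free_alg.span_minimal)
      (auto simp: subspace_multilinear_on multilinear_on_iff Poly_Mapping.lookup_single "when_def")
qed

lemma multilinear_on_finite_span:
  "finite (word ` permutations_of_set A)" "I \<inter> multilinear_on A \<subseteq> free_alg.span (word ` permutations_of_set A)"
  by (auto simp: multilinear_on_eq_span)

lemma map_permutes_permutations_of_set:
  "{map \<sigma> [0..<n] | \<sigma>. \<sigma> permutes {..<n}} = permutations_of_set {..<n}"
proof (intro equalityI subsetI)
  fix w assume "w \<in> {map \<sigma> [0..<n] | \<sigma>. \<sigma> permutes {..<n}}"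
  then obtain \<sigma> where "\<sigma> permutes {..<n}" "w = map \<sigma> [0..<n]" by blast
  then have "set w = {..<n}" "distinct w"
    using permutes_image[of \<sigma> "{..<n}"] permutes_inj_on[of \<sigma>]
    by (simp_all add: distinct_map atLeast0LessThan)
  then show "w \<in> permutations_of_set {..<n}" by (simp add: permutations_of_set_def)
next
  fix w assume "w \<in> permutations_of_set {..<n}"
  then have w: "set w = {..<n}" "distinct w" by (auto simp: permutations_of_set_def)
  then have len: "length w = n" using distinct_card[of w] by simp
  define \<sigma> where "\<sigma> i = (if i < n then w ! i else i)" for i
  have "bij_betw ((!) w) {..<n} {..<n}"
    by (rule bij_betw_nth) (simp_all add: w len)
  moreover have "bij_betw \<sigma> {..<n} {..<n} \<longleftrightarrow> bij_betw ((!) w) {..<n} {..<n}"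
    by (intro bij_betw_cong) (simp add: \<sigma>_def)
  ultimately have "bij_betw \<sigma> {..<n} {..<n}" by simp
  then have "\<sigma> permutes {..<n}" by (rule bij_imp_permutes) (simp add: \<sigma>_def)
  moreover have "w = map \<sigma> [0..<n]" using len by (intro nth_equalityI) (simp_all add: \<sigma>_def)
  ultimately show "w \<in> {map \<sigma> [0..<n] | \<sigma>. \<sigma> permutes {..<n}}" by blast
qed

lemma multilinear_eq: "(multilinear n :: 'k::field free_alg set) = multilinear_on {..<n}"
proof -
  have "{word (map \<sigma> [0..<n]) :: 'k free_alg | \<sigma>. \<sigma> permutes {..<n}} = word ` {map \<sigma> [0..<n] | \<sigma>. \<sigma> permutes {..<n}}"
    by blast
  then show ?thesis
    by (simp only: multilinear_def multilinear_on_eq_span map_permutes_permutations_of_set)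
qed

lemma dim_multilinear_on:
  assumes "finite A"
  shows "free_alg.dim (multilinear_on A :: 'k::field free_alg set) = fact (card A)"
proof -
  have "free_alg.dim (multilinear_on A :: 'k free_alg set) = card (permutations_of_set A)"
  proof (rule free_alg.dim_eq_card_family[where v = word])
    fix c :: "nat list \<Rightarrow> 'k"
    define f where "f = (\<Sum>w\<in>permutations_of_set A. free_scale (c w) (word w))"
    have "wcoeff f u = c u" if "u \<in> permutations_of_set A" for u
    proof -
      have "wcoeff f u = (\<Sum>w\<in>permutations_of_set A. if w = u then c u else 0)"
        unfolding f_def Poly_Mapping.lookup_sum
        by (intro sum.cong refl) (auto simp: lookup_free_scale Poly_Mapping.lookup_single "when_def")
      then show ?thesis using that by (simp add: sum.delta)
    qed
    moreover assume "(\<Sum>w\<in>permutations_of_set A. free_scale (c w) (word w)) = 0"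
    ultimately show "\<forall>w\<in>permutations_of_set A. c w = 0" by (simp flip: f_def)
  qed (auto simp: multilinear_on_eq_span free_alg.span_base)
  then show ?thesis using assms by simp
qed

lemma multilinear_on_mult:
  assumes "f \<in> multilinear_on A" "g \<in> multilinear_on C" "A \<inter> C = {}"
  shows "f * g \<in> multilinear_on (A \<union> C)"
proof -
  have "Poly_Mapping.keys (f * g) \<subseteq> {u @ v | u v. u \<in> permutations_of_set A \<and> v \<in> permutations_of_set C}"
    using keys_mult[of f g] assms(1,2) unfolding multilinear_on_def plus_list_def by blast
  also have "\<dots> \<subseteq> permutations_of_set (A \<union> C)"
    using assms(3) by (auto simp: permutations_of_set_def)
  finally show ?thesis by (simp add: multilinear_on_def)
qed

lemma multilinear_part_in: "multilinear_part A f \<in> multilinear_on A"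
  by (auto simp: multilinear_on_iff)

lemma multilinear_part_id: "f \<in> multilinear_on A \<Longrightarrow> multilinear_part A f = f"
  by (rule poly_mapping_eqI) (auto simp: multilinear_on_iff)

lemma multilinear_part_sum: "multilinear_part A (sum f S) = (\<Sum>i\<in>S. multilinear_part A (f i))"
  by (rule poly_mapping_eqI) (simp add: Poly_Mapping.lookup_sum)

text \<open>A word that uses each letter of \<open>B\<close> once is cut into two words on
  complementary letter sets, so for each cut exactly one \<open>A\<close> contributes, namely
  \<open>set (take i w)\<close>.\<close>

lemma multilinear_part_mult:
  assumes "finite B"
  shows "multilinear_part B (f * g) = (\<Sum>A\<in>Pow B. multilinear_part A f * multilinear_part (B - A) g)"
proof (rule poly_mapping_eqI)
  fix w
  let ?t = "\<lambda>A i. wcoeff (multilinear_part A f) (take i w) * wcoeff (multilinear_part (B - A) g) (drop i w)"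
  have yes: "(\<Sum>A\<in>Pow B. ?t A i) = wcoeff f (take i w) * wcoeff g (drop i w)"
    if w: "w \<in> permutations_of_set B" for i
  proof -
    have dist: "distinct (take i w @ drop i w)" and set: "set (take i w @ drop i w) = B"
      using w by (simp_all add: permutations_of_set_def)
    have "(\<Sum>A\<in>Pow B. ?t A i) = (\<Sum>A\<in>{set (take i w)}. ?t A i)"
      using assms set by (intro sum.mono_neutral_right) (auto simp: permutations_of_set_def dest: in_set_takeD)
    moreover have "set (drop i w) = B - set (take i w)"
      using dist set unfolding distinct_append set_append by blast
    ultimately show ?thesis using dist by (simp add: permutations_of_set_def)
  qed
  have no: "?t A i = 0" if "w \<notin> permutations_of_set B" "A \<in> Pow B" for A i
  proof (rule ccontr)
    assume "?t A i \<noteq> 0"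
    then have "take i w \<in> permutations_of_set A" "drop i w \<in> permutations_of_set (B - A)"
      by (auto split: if_splits)
    then have "take i w @ drop i w \<in> permutations_of_set B"
      using that(2) unfolding permutations_of_set_def mem_Collect_eq distinct_append set_append by blast
    with that(1) show False by simp
  qed
  have "(\<Sum>i\<le>length w. \<Sum>A\<in>Pow B. ?t A i) =
      (if w \<in> permutations_of_set B then wcoeff (f * g) w else 0)"
  proof (cases "w \<in> permutations_of_set B")
    case True
    then show ?thesis by (simp only: yes wcoeff_mult[of f] if_True)
  next
    case False
    then show ?thesis unfolding if_not_P[OF False] by (intro sum.neutral ballI no)
  qed
  then show "wcoeff (multilinear_part B (f * g)) w =
      wcoeff (\<Sum>A\<in>Pow B. multilinear_part A f * multilinear_part (B - A) g) w"
    unfolding Poly_Mapping.lookup_sum wcoeff_mult[of "multilinear_part _ f"] wcoeff_keep_words[of _ "f * g"]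
    by (subst sum.swap) (simp only:)
qed

section \<open>Symmetric ideals\<close>

text \<open>What the dimension count needs of a T-ideal. Closure under
  \<open>multilinear_part\<close> is where characteristic 0 will enter; renaming makes dimensions
  depend only on the number of letters. The whole algebra is an instance too, as needed for the
  comparison.\<close>

locale symmetric_ideal =
  fixes I :: "'k::field free_alg set"
  assumes subspace: "free_alg.subspace I"
    and mult_left: "f \<in> I \<Longrightarrow> g * f \<in> I"
    and mult_right: "f \<in> I \<Longrightarrow> f * g \<in> I"
    and part: "finite A \<Longrightarrow> f \<in> I \<Longrightarrow> multilinear_part A f \<in> I"
    and rename: "bij s \<Longrightarrow> f \<in> I \<Longrightarrow> rename_letters s f \<in> I"

lemma symmetric_ideal_UNIV: "symmetric_ideal UNIV"
  by unfold_locales auto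

abbreviation multilinear_dim :: "'k::field free_alg set \<Rightarrow> nat set \<Rightarrow> nat" where
  "multilinear_dim I A \<equiv> free_alg.dim (I \<inter> multilinear_on A)"

lemma rename_letters_linear: "bij s \<Longrightarrow> Vector_Spaces.linear free_scale free_scale (rename_letters s)"
  unfolding Vector_Spaces.linear_iff
  by (auto intro!: free_alg.vector_space_axioms poly_mapping_eqI simp: Poly_Mapping.lookup_add lookup_free_scale bij_is_inj)

lemma rename_letters_inj:
  assumes "bij s"
  shows "inj (rename_letters s)"
proof (rule injI)
  fix f g :: "'a::field free_alg" assume eq: "rename_letters s f = rename_letters s g"
  show "f = g"
  proof (rule poly_mapping_eqI)
    fix w
    have "map s (map (inv_into UNIV s) w) = w"
      using assms by (simp add: o_def bij_is_surj surj_f_inv_f)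
    then show "wcoeff f w = wcoeff g w"
      using arg_cong[OF eq, of "\<lambda>h. wcoeff h (map (inv_into UNIV s) w)"] assms by (simp add: bij_is_inj del: map_map)
  qed
qed

text \<open>\<open>rename_letters s\<close> is injective and pulls words back along
  \<open>s\<close>, so it leads from polynomials on \<open>A\<close> to polynomials on
  \<open>B\<close> although \<open>s\<close> maps \<open>B\<close> to \<open>A\<close>.\<close>

lemma multilinear_dim_le:
  assumes s: "bij s" "s ` B = A" and I: "\<And>f. f \<in> I \<Longrightarrow> rename_letters s f \<in> I"
  shows "multilinear_dim I A \<le> multilinear_dim I B"
proof -
  have img: "rename_letters s f \<in> I \<inter> multilinear_on B" if "f \<in> I \<inter> multilinear_on A" for f
  proof -
    have "wcoeff f (map s w) = 0" if "w \<notin> permutations_of_set B" for w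
    proof -
      have "map s w \<notin> permutations_of_set A"
        using that s by (auto simp: permutations_of_set_def distinct_map inj_image_eq_iff bij_is_inj)
      then show ?thesis using \<open>f \<in> I \<inter> multilinear_on A\<close> by (simp add: multilinear_on_iff)
    qed
    then show ?thesis using that I s(1) by (simp add: multilinear_on_iff bij_is_inj)
  qed
  obtain C where C: "C \<subseteq> I \<inter> multilinear_on A" "free_alg.independent C" "finite C" "card C = multilinear_dim I A"
    using free_alg.finite_basis_exists[OF multilinear_on_finite_span] by metis
  have "free_alg.independent (rename_letters s ` C)"
    using vector_space_pair.linear_independent_injective_image[OF _ rename_letters_linear[OF s(1)] C(2)]
    by (simp add: vector_space_pair_def free_alg.vector_space_axioms
        inj_on_subset[OF rename_letters_inj[OF s(1)]])
  then have "card (rename_letters s ` C) \<le> multilinear_dim I B"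
    using C(1) img by (intro free_alg.independent_card_le_dim_finite[OF multilinear_on_finite_span]) auto
  then show ?thesis
    using C(4) by (simp add: card_image inj_on_subset[OF rename_letters_inj[OF s(1)]])
qed

text \<open>A renaming has to permute all letters; the bijection between the finite sets is
  completed by one between their countably infinite complements.\<close>

lemma ex_bij_image_eq:
  fixes A B :: "nat set"
  assumes "finite A" "finite B" "card A = card B"
  shows "\<exists>s. bij s \<and> s ` A = B"
proof -
  obtain h where h: "bij_betw h A B" using assms finite_same_card_bij by blast
  have "infinite (- A)" "infinite (- B)" using assms by (auto simp: Compl_eq_Diff_UNIV intro: Diff_infinite_finite)
  then obtain k where k: "bij_betw k (- A) (- B)"
    by (meson bij_betw_inv bij_betw_trans bij_enumerate)
  define s where "s x = (if x \<in> A then h x else k x)" for x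
  have "bij_betw s A B \<longleftrightarrow> bij_betw h A B" "bij_betw s (- A) (- B) \<longleftrightarrow> bij_betw k (- A) (- B)"
    by (intro bij_betw_cong; simp add: s_def)+
  then have "bij_betw s A B" "bij_betw s (- A) (- B)" using h k by simp_all
  then have "bij_betw s (A \<union> - A) (B \<union> - B)" by (rule bij_betw_combine) simp
  moreover have "s ` A = B" using \<open>bij_betw s A B\<close> by (rule bij_betw_imp_surj_on)
  ultimately show ?thesis by auto
qed

lemma multilinear_dim_card:
  assumes "finite A" "finite B" "card A = card B" and I: "\<And>s f. bij s \<Longrightarrow> f \<in> I \<Longrightarrow> rename_letters s f \<in> I"
  shows "multilinear_dim I A = multilinear_dim I B"
proof (rule antisym)
  obtain s where "bij s" "s ` B = A" using ex_bij_image_eq[of B A] assms by auto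
  then show "multilinear_dim I A \<le> multilinear_dim I B" using multilinear_dim_le I by blast
  obtain s where "bij s" "s ` A = B" using ex_bij_image_eq[of A B] assms by auto
  then show "multilinear_dim I B \<le> multilinear_dim I A" using multilinear_dim_le I by blast
qed

section \<open>Products of symmetric ideals\<close>

lemma left_quotient_add: "left_quotient b (f + g) = left_quotient b f + left_quotient b g"
  and left_quotient_scale: "left_quotient b (free_scale c f) = free_scale c (left_quotient b f)"
  and left_quotient_0 [simp]: "left_quotient b 0 = 0"
  by (rule poly_mapping_eqI; simp add: Poly_Mapping.lookup_add lookup_free_scale)+

lemma left_quotient_sum: "left_quotient b (sum f S) = (\<Sum>i\<in>S. left_quotient b (f i))"
  by (rule poly_mapping_eqI) (simp add: Poly_Mapping.lookup_sum)

lemma word_Nil_mult [simp]: "word [] * f = f"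
  by (rule poly_mapping_eqI) (simp add: wcoeff_word_mult)

lemma left_quotient_word_mult:
  "left_quotient b (word (c # w) * f) = (if c = b then word w * f else 0)"
  by (rule poly_mapping_eqI) (auto simp: wcoeff_word_mult)

lemma left_quotient_multilinear_on:
  assumes "f \<in> multilinear_on C"
  shows "left_quotient b f \<in> multilinear_on (C - {b})"
  unfolding multilinear_on_iff
proof (intro allI impI)
  fix w assume "w \<notin> permutations_of_set (C - {b})"
  then have "b # w \<notin> permutations_of_set C" by (auto simp: permutations_of_set_def)
  then show "wcoeff (left_quotient b f) w = 0" using assms by (simp add: multilinear_on_iff)
qed

lemma left_quotient_expansion:
  assumes "finite C" "f \<in> multilinear_on C" "wcoeff f [] = 0"
  shows "f = (\<Sum>b\<in>C. word [b] * left_quotient b f)"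
proof (rule poly_mapping_eqI)
  fix u
  show "wcoeff f u = wcoeff (\<Sum>b\<in>C. word [b] * left_quotient b f) u"
  proof (cases u)
    case Nil
    then show ?thesis using assms(3) by (simp add: Poly_Mapping.lookup_sum wcoeff_word_mult)
  next
    case (Cons c w)
    have "c \<notin> C \<Longrightarrow> wcoeff f u = 0"
      using assms(2) unfolding multilinear_on_iff Cons
      by (metis list.set_intros(1) permutations_of_setD(1))
    then show ?thesis
      using assms(1) by (simp add: Poly_Mapping.lookup_sum wcoeff_word_mult Cons sum.delta)
  qed
qed

text \<open>The product of the augmentation ideal with the left ideal \<open>I\<close>, read off letter by letter.\<close>

definition augmentation_times :: "'k::field free_alg set \<Rightarrow> 'k free_alg set" where
  "augmentation_times I = {f. wcoeff f [] = 0 \<and> (\<forall>b. left_quotient b f \<in> I)}"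

text \<open>\<open>G\<close> is a basis of a complement of \<open>F_+ I\<close> in \<open>I\<close>,
  in the component on the letters \<open>C\<close>: a lift of a basis of the quotient, as in the
  graded Nakayama lemma.\<close>

definition minimal_generators :: "'k::field free_alg set \<Rightarrow> nat set \<Rightarrow> 'k free_alg set \<Rightarrow> bool" where
  "minimal_generators I C G \<longleftrightarrow> G \<subseteq> I \<inter> multilinear_on C \<and> free_alg.independent G \<and> finite G \<and>
     (\<forall>f\<in>I \<inter> multilinear_on C. \<exists>g\<in>free_alg.span G. f - g \<in> augmentation_times I) \<and>
     free_alg.span G \<inter> augmentation_times I \<subseteq> {0} \<and>
     card G + multilinear_dim (augmentation_times I) C = multilinear_dim I C"

definition words_in :: "nat set \<Rightarrow> nat list set" where
  "words_in B = {w. distinct w \<and> set w \<subseteq> B}"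

lemma words_in_eq: "words_in B = (\<Union>A\<in>Pow B. permutations_of_set A)"
  by (auto simp: words_in_def permutations_of_set_def)

lemma finite_words_in: "finite B \<Longrightarrow> finite (words_in B)"
  by (simp add: words_in_eq)

lemma sum_words_in:
  assumes "finite B"
  shows "sum f (words_in B) = (\<Sum>A\<in>Pow B. sum f (permutations_of_set A))"
  unfolding words_in_eq using assms
  by (intro sum.UNION_disjoint) (auto dest: permutations_of_setD)

lemma mult_in_span:
  assumes f: "f \<in> free_alg.span S" and g: "g \<in> free_alg.span T"
    and prod: "\<And>x y. x \<in> S \<Longrightarrow> y \<in> T \<Longrightarrow> x * y \<in> free_alg.span U"
  shows "f * g \<in> free_alg.span U"
  using f
proof (induction rule: free_alg.span_induct_alt)
  case (step c x y)
  have "x * g \<in> free_alg.span U"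
    using g
  proof (induction rule: free_alg.span_induct_alt)
    case (step d u v)
    then show ?case using prod[OF \<open>x \<in> S\<close>]
      by (simp add: distrib_left free_scale_mult_right free_alg.span_add free_alg.span_scale)
  qed (simp add: free_alg.span_zero)
  with step show ?case
    by (simp add: distrib_right free_scale_mult_left free_alg.span_add free_alg.span_scale)
qed (simp add: free_alg.span_zero)

context symmetric_ideal
begin

lemma subspace_augmentation_times: "free_alg.subspace (augmentation_times I)"
  using free_alg.subspace_0[OF subspace] free_alg.subspace_add[OF subspace] free_alg.subspace_scale[OF subspace]
  by (auto simp: free_alg.subspace_def augmentation_times_def left_quotient_add left_quotient_scale
      Poly_Mapping.lookup_add lookup_free_scale)

lemma augmentation_times_subset:
  assumes "finite C"
  shows "augmentation_times I \<inter> multilinear_on C \<subseteq> I"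
proof
  fix f assume f: "f \<in> augmentation_times I \<inter> multilinear_on C"
  have "(\<Sum>b\<in>C. word [b] * left_quotient b f) \<in> I"
    using f by (intro free_alg.subspace_sum[OF subspace] mult_left) (auto simp: augmentation_times_def)
  then show "f \<in> I"
    using left_quotient_expansion[OF assms, of f] f by (simp add: augmentation_times_def)
qed

lemma augmentation_times_rename:
  assumes "bij s" "f \<in> augmentation_times I"
  shows "rename_letters s f \<in> augmentation_times I"
proof -
  have "left_quotient b (rename_letters s f) = rename_letters s (left_quotient (s b) f)" for b
    by (rule poly_mapping_eqI) (simp add: bij_is_inj[OF assms(1)])
  then show ?thesis
    using assms rename[OF assms(1)] by (simp add: augmentation_times_def bij_is_inj)
qed

lemma minimal_generators_exist:
  assumes C: "finite C"
  shows "\<exists>G. minimal_generators I C G"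
proof -
  let ?V = "I \<inter> multilinear_on C" and ?U = "augmentation_times I \<inter> multilinear_on C"
  have V: "free_alg.subspace ?V" and U: "free_alg.subspace ?U"
    using subspace subspace_augmentation_times subspace_multilinear_on
    by (auto intro: free_alg.subspace_inter)
  have UV: "?U \<subseteq> ?V" using augmentation_times_subset[OF C] by blast
  obtain G where G: "G \<subseteq> ?V" "free_alg.independent G" "finite G"
    "\<And>v. v \<in> ?V \<Longrightarrow> \<exists>g\<in>free_alg.span G. v - g \<in> ?U" "free_alg.span G \<inter> ?U \<subseteq> {0}"
    "card G + free_alg.dim ?U = free_alg.dim ?V"
    by (rule free_alg.complement_basis_exists[OF V U UV multilinear_on_finite_span], rule that)
  have "free_alg.span G \<subseteq> ?V" using free_alg.span_minimal[OF G(1) V] .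
  then have "free_alg.span G \<inter> augmentation_times I \<subseteq> {0}" using G(5) by blast
  moreover have "\<exists>g\<in>free_alg.span G. v - g \<in> augmentation_times I" if "v \<in> ?V" for v
    using G(4)[OF that] by blast
  ultimately show ?thesis using G(1-3,6) unfolding minimal_generators_def by blast
qed

text \<open>
  Freeness of \<open>I\<close> as a left module: stripping the first letter of a relation shows that its
  constant term lies in the augmentation product, hence vanishes; then recurse.
\<close>

lemma word_combination_eq_0D:
  assumes minG: "\<And>C. finite C \<Longrightarrow> minimal_generators I C (G C)"
    and "finite B" and "\<And>w. w \<in> words_in B \<Longrightarrow> g w \<in> free_alg.span (G (B - set w))"
    and "(\<Sum>w\<in>words_in B. word w * g w) = 0" and "w \<in> words_in B"
  shows "g w = 0"
  using assms(2-)
proof (induction B arbitrary: g w rule: finite_psubset_induct)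
  case (psubset B)
  have G: "G C \<subseteq> I \<inter> multilinear_on C" "free_alg.span (G C) \<inter> augmentation_times I \<subseteq> {0}"
    if "finite C" for C
    using minG[OF that] by (simp_all add: minimal_generators_def)
  have Nil: "[] \<in> words_in B" by (simp add: words_in_def)
  have spanI: "free_alg.span (G C) \<subseteq> I" "free_alg.span (G C) \<subseteq> multilinear_on C" if "finite C" for C
    using G(1)[OF that] by (auto intro!: free_alg.span_minimal subspace subspace_multilinear_on del: subsetI)
  have inI: "g w \<in> I" if "w \<in> words_in B" for w
    using psubset.prems(1)[OF that] spanI(1)[of "B - set w"] psubset.hyps by auto
  have g0: "g [] \<in> free_alg.span (G B)" using psubset.prems(1)[OF Nil] by simp
  \<comment> \<open>For \<open>b\<close> outside \<open>B\<close> the set has to be empty: no word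
    over \<open>B\<close> begins with \<open>b\<close>, while \<open>words_in (B - {b})\<close>
    would be all of \<open>words_in B\<close>.\<close>
  define tails where "tails b = (if b \<in> B then words_in (B - {b}) else {})" for b
  have tails: "v \<in> tails b \<longleftrightarrow> b # v \<in> words_in B" for b v
    by (auto simp: tails_def words_in_def)
  \<comment> \<open>The left quotient kills every term whose word begins with a letter other than
    \<open>b\<close>; the empty word contributes \<open>left_quotient b (g [])\<close>.\<close>
  have strip: "left_quotient b (g []) + (\<Sum>v\<in>tails b. word v * g (b # v)) = 0" for b
  proof -
    have zero: "left_quotient b (word w * g w) = 0" if "w \<in> (words_in B - {[]}) - Cons b ` tails b" for w
    proof -
      have "w \<noteq> []" using that by blast
      then obtain c u where w: "w = c # u" by (cases w) blast+
      have "c \<noteq> b" using that tails[of u b] unfolding w by blast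
      then show ?thesis by (simp add: w left_quotient_word_mult)
    qed
    have fin: "finite (words_in B)" by (rule finite_words_in[OF psubset.hyps])
    have "left_quotient b (\<Sum>w\<in>words_in B. word w * g w) =
        left_quotient b (g []) + (\<Sum>w\<in>words_in B - {[]}. left_quotient b (word w * g w))"
      unfolding sum.remove[OF fin Nil] by (simp add: left_quotient_add left_quotient_sum)
    also have "(\<Sum>w\<in>words_in B - {[]}. left_quotient b (word w * g w)) =
        (\<Sum>w\<in>Cons b ` tails b. left_quotient b (word w * g w))"
    proof (rule sum.mono_neutral_right)
      show "finite (words_in B - {[]})" using fin by simp
      show "Cons b ` tails b \<subseteq> words_in B - {[]}" using tails by blast
    qed (use zero in blast)
    also have "\<dots> = (\<Sum>v\<in>tails b. word v * g (b # v))"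
      by (subst sum.reindex) (simp_all add: left_quotient_word_mult)
    finally show ?thesis unfolding psubset.prems(2) by simp
  qed
  have "left_quotient b (g []) \<in> I" for b
  proof -
    have "left_quotient b (g []) = - (\<Sum>v\<in>tails b. word v * g (b # v))"
      using strip[of b] by (simp add: eq_neg_iff_add_eq_0)
    also have "\<dots> \<in> I"
      by (intro free_alg.subspace_neg[OF subspace] free_alg.subspace_sum[OF subspace] mult_left inI)
        (simp add: tails)
    finally show ?thesis .
  qed
  \<comment> \<open>If letters are left, the empty word is not a permutation of \<open>B\<close>; if
    none are left, the relation itself reads \<open>g [] = 0\<close>.\<close>
  moreover have "wcoeff (g []) [] = 0"
  proof (cases "B = {}")
    case True
    then have "words_in B = {[]}" by (auto simp: words_in_def)
    then show ?thesis using psubset.prems(2) by simp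
  next
    case False
    then have "[] \<notin> permutations_of_set B" by (simp add: permutations_of_set_def)
    moreover have "g [] \<in> multilinear_on B" using g0 spanI(2)[OF psubset.hyps] by blast
    ultimately show ?thesis by (simp add: multilinear_on_iff)
  qed
  ultimately have "g [] \<in> augmentation_times I" by (simp add: augmentation_times_def)
  then have gNil: "g [] = 0" using g0 G(2)[OF psubset.hyps] by blast
  show ?case
  proof (cases w)
    case Nil
    then show ?thesis using gNil by simp
  next
    case (Cons b v)
    then have b: "b \<in> B" and v: "v \<in> words_in (B - {b})" using psubset.prems(3) by (auto simp: words_in_def)
    \<comment> \<open>Once \<open>g []\<close> is gone, the stripped relation has the original shape
      over \<open>B - {b}\<close>.\<close>
    have "g (b # v) = 0"
    proof (rule psubset.IH[of "B - {b}" "\<lambda>v. g (b # v)"])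
      show "B - {b} \<subset> B" using b by blast
      show "g (b # u) \<in> free_alg.span (G (B - {b} - set u))" if "u \<in> words_in (B - {b})" for u
      proof -
        have "b # u \<in> words_in B" using that b by (auto simp: words_in_def)
        moreover have "B - {b} - set u = B - set (b # u)" by auto
        ultimately show ?thesis using psubset.prems(1) by metis
      qed
      show "(\<Sum>u\<in>words_in (B - {b}). word u * g (b # u)) = 0"
        using strip[of b] b gNil by (simp add: tails_def)
    qed (rule v)
    then show ?thesis by (simp add: Cons)
  qed
qed

end

lemma ideal_timesI: "f \<in> I \<Longrightarrow> g \<in> J \<Longrightarrow> f * g \<in> ideal_times I J"
  unfolding ideal_times_def mem_Collect_eq
  by (rule exI[of _ "1::nat"], rule exI[of _ "\<lambda>_. f"], rule exI[of _ "\<lambda>_. g"]) simp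

text \<open>The products of a basis element of \<open>I\<close> on \<open>A\<close> with a minimal
  generator of \<open>J\<close> on \<open>B - A\<close> form a basis. Independence reduces to
  freeness of \<open>J\<close> by expanding the left factors into words. The natural-number
  difference is exact, since it counts the generators.\<close>

lemma multilinear_dim_ideal_times:
  fixes I J :: "'k::field free_alg set"
  assumes I: "symmetric_ideal I" and J: "symmetric_ideal J" and B: "finite B"
  shows "multilinear_dim (ideal_times I J) B = (\<Sum>A\<in>Pow B. multilinear_dim I A *
    (multilinear_dim J (B - A) - multilinear_dim (augmentation_times J) (B - A)))"
proof -
  interpret I: symmetric_ideal I by fact
  interpret J: symmetric_ideal J by fact
  obtain G where minG: "\<And>C. finite C \<Longrightarrow> minimal_generators J C (G C)"
    using J.minimal_generators_exist by metis
  have G: "G C \<subseteq> J \<inter> multilinear_on C" "free_alg.independent (G C)" "finite (G C)"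
      "card (G C) + multilinear_dim (augmentation_times J) C = multilinear_dim J C" if "finite C" for C
    using minG[OF that] by (simp_all add: minimal_generators_def)
  have Ggen: "\<exists>g\<in>free_alg.span (G C). f - g \<in> augmentation_times J"
    if "finite C" "f \<in> J \<inter> multilinear_on C" for C f
    using minG[OF that(1)] that(2) by (simp add: minimal_generators_def)
  define ok where "ok A F \<longleftrightarrow> F \<subseteq> I \<inter> multilinear_on A \<and> free_alg.independent F \<and>
      I \<inter> multilinear_on A \<subseteq> free_alg.span F \<and> finite F \<and> card F = multilinear_dim I A" for A F
  have "\<exists>F. ok A F" for A
    by (rule free_alg.finite_basis_exists[OF multilinear_on_finite_span, of I A]) (unfold ok_def, blast)
  then obtain F where ok: "\<And>A. ok A (F A)" by metis
  note F = ok[unfolded ok_def, THEN conjunct1] ok[unfolded ok_def, THEN conjunct2, THEN conjunct1]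
    ok[unfolded ok_def, THEN conjunct2, THEN conjunct2, THEN conjunct1]
    ok[unfolded ok_def, THEN conjunct2, THEN conjunct2, THEN conjunct2, THEN conjunct1]
    ok[unfolded ok_def, THEN conjunct2, THEN conjunct2, THEN conjunct2, THEN conjunct2]
  define Idx where "Idx = (SIGMA A:Pow B. F A \<times> G (B - A))"
  define v where "v = (\<lambda>(A :: nat set, f, g). f * g :: 'k free_alg)"
  have finD: "finite (B - A)" for A using B by simp
  \<comment> \<open>\<open>A\<close> has to vary in the induction on \<open>C\<close>, because
    letters migrate from the right factor to the left one.\<close>
  have span: "f * h \<in> free_alg.span (v ` Idx)"
    if "f \<in> I \<inter> multilinear_on A" "h \<in> J \<inter> multilinear_on C" "A \<inter> C = {}" "A \<union> C = B" for f h A C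
  proof -
    have "finite C" using that(4) B by (meson finite_Un)
    then show ?thesis using that
    proof (induction C arbitrary: f h A rule: finite_psubset_induct)
      case (psubset C)
      then have C: "C = B - A" and A: "A \<in> Pow B" by blast+
      obtain g where g: "g \<in> free_alg.span (G C)" "h - g \<in> augmentation_times J"
        using Ggen[OF psubset.hyps psubset.prems(2)] by blast
      have "f * g \<in> free_alg.span (v ` Idx)"
      proof (rule mult_in_span[OF _ g(1)])
        show "f \<in> free_alg.span (F A)" using psubset.prems(1) F(3) by blast
        fix x y assume "x \<in> F A" "y \<in> G C"
        then have "(A, x, y) \<in> Idx" using A C by (simp add: Idx_def)
        then have "v (A, x, y) \<in> v ` Idx" by (rule imageI)
        then show "x * y \<in> free_alg.span (v ` Idx)" by (simp add: v_def free_alg.span_base)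
      qed
      \<comment> \<open>\<open>h - g\<close> lies in \<open>F_+ J\<close>, so it is a sum of terms
        \<open>x_b h_b\<close> with \<open>h_b\<close> in \<open>J\<close>. The letter
        \<open>x_b\<close> is absorbed by \<open>f\<close>, as \<open>I\<close> is closed under
        multiplication from the right.\<close>
      moreover have "f * (h - g) \<in> free_alg.span (v ` Idx)"
      proof -
        have "free_alg.span (G C) \<subseteq> multilinear_on C"
          using G(1)[OF psubset.hyps] by (intro free_alg.span_minimal subspace_multilinear_on) auto
        then have hg: "h - g \<in> multilinear_on C"
          using g(1) psubset.prems(2) free_alg.subspace_diff[OF subspace_multilinear_on] by blast
        have "h - g = (\<Sum>b\<in>C. word [b] * left_quotient b (h - g))"
          using g(2) by (intro left_quotient_expansion psubset.hyps hg) (simp add: augmentation_times_def)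
        then have "f * (h - g) = f * (\<Sum>b\<in>C. word [b] * left_quotient b (h - g))"
          by (rule arg_cong)
        also have "\<dots> = (\<Sum>b\<in>C. f * word [b] * left_quotient b (h - g))"
          by (simp add: mult.assoc sum_distrib_left)
        also have "\<dots> \<in> free_alg.span (v ` Idx)"
        proof (rule free_alg.span_sum)
          fix b assume b: "b \<in> C"
          have "word [b] \<in> multilinear_on {b}"
            by (auto simp: multilinear_on_iff Poly_Mapping.lookup_single "when_def")
          then have "f * word [b] \<in> multilinear_on (A \<union> {b})"
            using psubset.prems b by (intro multilinear_on_mult) auto
          moreover have "f * word [b] \<in> I" using psubset.prems(1) I.mult_right by blast
          moreover have "left_quotient b (h - g) \<in> J \<inter> multilinear_on (C - {b})"
            using g(2) left_quotient_multilinear_on[OF hg] by (auto simp: augmentation_times_def)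
          ultimately show "f * word [b] * left_quotient b (h - g) \<in> free_alg.span (v ` Idx)"
            using b psubset.prems(3,4) by (intro psubset.IH[of "C - {b}" _ "A \<union> {b}"]) auto
        qed
        finally show ?thesis .
      qed
      ultimately have "f * g + f * (h - g) \<in> free_alg.span (v ` Idx)" by (rule free_alg.span_add)
      then show ?case by (simp add: algebra_simps)
    qed
  qed
  have "multilinear_dim (ideal_times I J) B = card Idx"
  proof (rule free_alg.dim_eq_card_family[where v = v])
    show "finite Idx" using B F(4) G(3)[OF finD] by (auto simp: Idx_def)
  next
    fix i assume "i \<in> Idx"
    then obtain A f g where i: "i = (A, f, g)" "A \<subseteq> B" "f \<in> F A" "g \<in> G (B - A)"
      by (auto simp: Idx_def)
    then have f: "f \<in> I \<inter> multilinear_on A" and g: "g \<in> J \<inter> multilinear_on (B - A)"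
      using F(1) G(1)[OF finD] by blast+
    then have "f * g \<in> multilinear_on (A \<union> (B - A))" by (intro multilinear_on_mult) auto
    moreover have "A \<union> (B - A) = B" using i(2) by blast
    ultimately show "v i \<in> ideal_times I J \<inter> multilinear_on B"
      using f g by (simp add: i(1) v_def ideal_timesI)
  next
    show "ideal_times I J \<inter> multilinear_on B \<subseteq> free_alg.span (v ` Idx)"
    proof
      fix h assume h: "h \<in> ideal_times I J \<inter> multilinear_on B"
      then obtain n :: nat and a b where ab: "h = (\<Sum>i<n. a i * b i)" "\<And>i. i < n \<Longrightarrow> a i \<in> I \<and> b i \<in> J"
        unfolding ideal_times_def by blast
      \<comment> \<open>The factors \<open>a i\<close> and \<open>b i\<close> need not be
        multilinear; projecting the whole sum replaces them by multilinear parts on complementary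
        letter sets.\<close>
      have "h = multilinear_part B h" using h by (simp add: multilinear_part_id)
      also have "\<dots> = (\<Sum>i<n. \<Sum>A\<in>Pow B. multilinear_part A (a i) * multilinear_part (B - A) (b i))"
        by (simp add: ab(1) multilinear_part_sum multilinear_part_mult[OF B])
      also have "\<dots> \<in> free_alg.span (v ` Idx)"
      proof (intro free_alg.span_sum)
        fix i A assume "i \<in> {..<n}" "A \<in> Pow B"
        then have "a i \<in> I" "b i \<in> J" "finite A" "A \<subseteq> B" using ab(2) B finite_subset by auto
        then show "multilinear_part A (a i) * multilinear_part (B - A) (b i) \<in> free_alg.span (v ` Idx)"
          by (intro span[of _ A _ "B - A"]) (auto simp: I.part J.part B multilinear_part_in)
      qed
      finally show "h \<in> free_alg.span (v ` Idx)" .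
    qed
  next
    fix c assume "(\<Sum>i\<in>Idx. free_scale (c i) (v i)) = 0"
    \<comment> \<open>The right-hand cofactor of the word \<open>w\<close> after every
      \<open>x\<close> is expanded into words; \<open>set w\<close> recovers the letter set
      \<open>A\<close>.\<close>
    define g where "g w = (\<Sum>y\<in>G (B - set w). free_scale (\<Sum>x\<in>F (set w). c (set w, x, y) * wcoeff x w) y)" for w
    have expand: "x = (\<Sum>w\<in>permutations_of_set A. free_scale (wcoeff x w) (word w))" if "x \<in> F A" for x A
      using F(1) that by (intro word_expansion) (auto simp: multilinear_on_def)
    have "(\<Sum>i\<in>Idx. free_scale (c i) (v i)) =
        (\<Sum>A\<in>Pow B. \<Sum>p\<in>F A \<times> G (B - A). free_scale (c (A, p)) (v (A, p)))"
      unfolding Idx_def using B F(4) G(3)[OF finD] by (subst sum.Sigma) (auto simp: split_def)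
    also have "\<dots> = (\<Sum>A\<in>Pow B. \<Sum>x\<in>F A. \<Sum>y\<in>G (B - A). free_scale (c (A, x, y)) (x * y))"
      by (simp add: sum.cartesian_product v_def split_def)
    also have "\<dots> = (\<Sum>A\<in>Pow B. \<Sum>w\<in>permutations_of_set A. word w * g w)"
    proof (rule sum.cong[OF refl])
      fix A assume "A \<in> Pow B"
      have "(\<Sum>x\<in>F A. \<Sum>y\<in>G (B - A). free_scale (c (A, x, y)) (x * y)) =
          (\<Sum>x\<in>F A. \<Sum>y\<in>G (B - A). \<Sum>w\<in>permutations_of_set A.
             free_scale (c (A, x, y) * wcoeff x w) (word w * y))"
      proof (intro sum.cong refl)
        fix x y assume "x \<in> F A"
        have "x * y = (\<Sum>w\<in>permutations_of_set A. free_scale (wcoeff x w) (word w * y))"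
          using arg_cong[OF expand[OF \<open>x \<in> F A\<close>], of "\<lambda>t. t * y"]
          by (simp add: sum_distrib_right free_scale_mult_left)
        then show "free_scale (c (A, x, y)) (x * y) = (\<Sum>w\<in>permutations_of_set A.
             free_scale (c (A, x, y) * wcoeff x w) (word w * y))"
          by (simp add: free_alg.scale_sum_right)
      qed
      also have "\<dots> = (\<Sum>x\<in>F A. \<Sum>w\<in>permutations_of_set A. \<Sum>y\<in>G (B - A).
             free_scale (c (A, x, y) * wcoeff x w) (word w * y))"
        by (intro sum.cong refl sum.swap)
      also have "\<dots> = (\<Sum>w\<in>permutations_of_set A. \<Sum>x\<in>F A. \<Sum>y\<in>G (B - A).
             free_scale (c (A, x, y) * wcoeff x w) (word w * y))"
        by (rule sum.swap)
      also have "\<dots> = (\<Sum>w\<in>permutations_of_set A. \<Sum>y\<in>G (B - A). \<Sum>x\<in>F A.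
             free_scale (c (A, x, y) * wcoeff x w) (word w * y))"
        by (intro sum.cong refl sum.swap)
      also have "\<dots> = (\<Sum>w\<in>permutations_of_set A. word w * g w)"
      proof (rule sum.cong[OF refl])
        fix w assume "w \<in> permutations_of_set A"
        then have "set w = A" by (simp add: permutations_of_set_def)
        then show "(\<Sum>y\<in>G (B - A). \<Sum>x\<in>F A. free_scale (c (A, x, y) * wcoeff x w) (word w * y)) = word w * g w"
          by (simp add: g_def sum_distrib_left free_scale_mult_right free_alg.scale_sum_left)
      qed
      finally show "(\<Sum>x\<in>F A. \<Sum>y\<in>G (B - A). free_scale (c (A, x, y)) (x * y)) =
          (\<Sum>w\<in>permutations_of_set A. word w * g w)" .
    qed
    also have "\<dots> = (\<Sum>w\<in>words_in B. word w * g w)" by (simp add: sum_words_in[OF B])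
    finally have rel: "(\<Sum>w\<in>words_in B. word w * g w) = 0"
      using \<open>(\<Sum>i\<in>Idx. free_scale (c i) (v i)) = 0\<close> by simp
    have g0: "g w = 0" if "w \<in> words_in B" for w
    proof (rule J.word_combination_eq_0D[OF minG B _ rel that])
      show "g w \<in> free_alg.span (G (B - set w))" for w
        unfolding g_def by (intro free_alg.span_sum free_alg.span_scale free_alg.span_base)
    qed
    show "\<forall>i\<in>Idx. c i = 0"
    proof
      fix i assume "i \<in> Idx"
      then obtain A x y where i: "i = (A, x, y)" "A \<subseteq> B" "x \<in> F A" "y \<in> G (B - A)"
        by (auto simp: Idx_def)
      \<comment> \<open>For each word \<open>w\<close> on \<open>A\<close>, \<open>g w = 0\<close>
        and the independence of the generators annihilate the coefficient of \<open>y\<close>. Taken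
        over all \<open>w\<close>, this is a relation among the basis elements of
        \<open>I\<close>.\<close>
      have "(\<Sum>x\<in>F A. free_scale (c (A, x, y)) x) = 0"
      proof (rule poly_mapping_eqI)
        fix w
        have "(\<Sum>x\<in>F A. c (A, x, y) * wcoeff x w) = 0"
        proof (cases "w \<in> permutations_of_set A")
          case True
          then have w: "set w = A" "w \<in> words_in B" using i(2) by (auto simp: permutations_of_set_def words_in_def)
          then show ?thesis
            using free_alg.independentD[OF G(2) G(3) order.refl g0[OF w(2), unfolded g_def], of y] finD i(4) by simp
        next
          case False
          then have "wcoeff x w = 0" if "x \<in> F A" for x
            using F(1)[of A] that by (metis IntD2 multilinear_on_iff subsetD)
          then show ?thesis by simp
        qed
        then show "wcoeff (\<Sum>x\<in>F A. free_scale (c (A, x, y)) x) w = wcoeff 0 w"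
          by (simp add: Poly_Mapping.lookup_sum lookup_free_scale)
      qed
      then show "c i = 0"
        using free_alg.independentD[where u = "\<lambda>x. c (A, x, y)" and v = x, OF F(2)[of A] F(4)[of A] order.refl] i(1,3) by simp
    qed
  qed
  also have "card Idx = (\<Sum>A\<in>Pow B. card (F A) * card (G (B - A)))"
    unfolding Idx_def using B F(4) G(3)[OF finD] by (simp add: card_SigmaI card_cartesian_product)
  also have "\<dots> = (\<Sum>A\<in>Pow B. multilinear_dim I A *
    (multilinear_dim J (B - A) - multilinear_dim (augmentation_times J) (B - A)))"
  proof (rule sum.cong[OF refl])
    fix A
    have "card (G (B - A)) = multilinear_dim J (B - A) - multilinear_dim (augmentation_times J) (B - A)"
      unfolding G(4)[OF finD, of A, symmetric] by simp
    then show "card (F A) * card (G (B - A)) = multilinear_dim I A *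
        (multilinear_dim J (B - A) - multilinear_dim (augmentation_times J) (B - A))"
      by (simp only: F(5))
  qed
  finally show ?thesis .
qed

section \<open>T-ideals\<close>

text \<open>The substitution of \<open>2 x_b\<close> for \<open>x_b\<close>. The scalar 2 is chosen
  because its powers are pairwise distinct in characteristic 0.\<close>

definition dilate :: "nat \<Rightarrow> 'k::field free_alg \<Rightarrow> 'k free_alg" where
  "dilate b = Poly_Mapping.mapp (\<lambda>w a. 2 ^ count_list w b * a)"

lemma wcoeff_dilate [simp]: "wcoeff (dilate b f) w = 2 ^ count_list w b * wcoeff f w"
  by (auto simp: dilate_def Poly_Mapping.lookup_mapp "when_def" in_keys_iff)

text \<open>Homogeneous components are eigenvectors of a dilation, with distinct eigenvalues.\<close>

lemma homogeneous_component_in_subspace: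
  fixes f :: "'k::field_char_0 free_alg"
  assumes U: "free_alg.subspace U" and dil: "\<And>f. f \<in> U \<Longrightarrow> dilate b f \<in> U"
    and "finite M" "f \<in> U" "\<And>w. w \<in> Poly_Mapping.keys f \<Longrightarrow> count_list w b \<in> M"
  shows "keep_words {w. count_list w b = j} f \<in> U"
  using assms(3-)
proof (induction M arbitrary: f j)
  case empty
  then have "Poly_Mapping.keys f = {}" by blast
  then have "keep_words {w. count_list w b = j} f = 0"
    by (intro poly_mapping_eqI) (simp add: in_keys_iff [symmetric] flip: not_in_keys_iff_lookup_eq_zero)
  then show ?case by (simp add: free_alg.subspace_0[OF U])
next
  case (insert m M)
  let ?k = "\<lambda>j. keep_words {w. count_list w b = j}"
  \<comment> \<open>The component of degree \<open>m\<close> in the letter \<open>b\<close> cancels,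
    while that of degree \<open>j\<close> is multiplied by the nonzero number
    \<open>2 ^ j - 2 ^ m\<close>, which can be divided out again.\<close>
  define h where "h = dilate b f - free_scale (2 ^ m) f"
  have "h \<in> U"
    unfolding h_def using insert.prems(1)
    by (intro free_alg.subspace_diff[OF U] dil free_alg.subspace_scale[OF U])
  moreover have "count_list w b \<in> M" if "w \<in> Poly_Mapping.keys h" for w
  proof -
    have "wcoeff h w = (2 ^ count_list w b - 2 ^ m) * wcoeff f w"
      by (simp add: h_def Poly_Mapping.lookup_minus lookup_free_scale left_diff_distrib)
    then have "wcoeff f w \<noteq> 0" "count_list w b \<noteq> m" using that by (auto simp: in_keys_iff)
    then show ?thesis using insert.prems(2)[of w] by (auto simp: in_keys_iff)
  qed
  ultimately have IH: "?k j h \<in> U" for j by (rule insert.IH)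
  have other: "?k j f \<in> U" if "j \<noteq> m" for j
  proof -
    have "(2 :: 'k) ^ j \<noteq> 2 ^ m"
    proof
      assume "(2 :: 'k) ^ j = 2 ^ m"
      then have "of_nat (2 ^ j) = (of_nat (2 ^ m) :: 'k)" by simp
      then show False using that by (simp only: of_nat_eq_iff) simp
    qed
    then have "?k j f = free_scale (1 / (2 ^ j - 2 ^ m)) (?k j h)"
      by (intro poly_mapping_eqI)
        (auto simp: h_def Poly_Mapping.lookup_minus lookup_free_scale field_simps)
    then show ?thesis using IH[of j] by (simp add: free_alg.subspace_scale[OF U])
  qed
  show ?case
  proof (cases "j = m")
    case True
    \<comment> \<open>The one degree lost in \<open>h\<close> is recovered by subtracting all the
      others from \<open>f\<close>.\<close>
    have "?k m f = f - (\<Sum>j\<in>M. ?k j f)"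
    proof (rule poly_mapping_eqI)
      fix w
      have "(\<Sum>j\<in>M. wcoeff (?k j f) w) = (\<Sum>j\<in>M. if count_list w b = j then wcoeff f w else 0)"
        by (intro sum.cong refl) simp
      also have "\<dots> = (if count_list w b \<in> M then wcoeff f w else 0)"
        using insert.hyps(1) by (simp add: sum.delta')
      finally show "wcoeff (?k m f) w = wcoeff (f - (\<Sum>j\<in>M. ?k j f)) w"
        using insert.prems(2)[of w] insert.hyps(2)
        by (auto simp: Poly_Mapping.lookup_minus Poly_Mapping.lookup_sum in_keys_iff)
    qed
    moreover have "(\<Sum>j\<in>M. ?k j f) \<in> U"
      using insert.hyps(2) by (intro free_alg.subspace_sum[OF U] other) auto
    ultimately show ?thesis
      using True free_alg.subspace_diff[OF U insert.prems(1)] by simp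
  qed (rule other)
qed

lemma permutations_of_set_iff_count_list:
  "w \<in> permutations_of_set A \<longleftrightarrow> (\<forall>b. count_list w b = (if b \<in> A then 1 else 0))"
proof
  assume "w \<in> permutations_of_set A"
  then show "\<forall>b. count_list w b = (if b \<in> A then 1 else 0)"
    by (auto simp: permutations_of_set_def distinct_count_atmost_1 count_mset)
next
  assume c: "\<forall>b. count_list w b = (if b \<in> A then 1 else 0)"
  then have "set w = A" by (metis count_list_0_iff subsetI subset_antisym zero_neq_one)
  then show "w \<in> permutations_of_set A"
    using c by (auto simp: permutations_of_set_def distinct_count_atmost_1 count_mset)
qed

text \<open>The multilinear part is the component of degree 1 in each letter of \<open>A\<close> and
  degree 0 in every other. Only \<open>A\<close> and the letters occurring in \<open>f\<close>
  impose a condition, so finitely many homogeneous projections suffice.\<close>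

lemma multilinear_part_in_subspace:
  fixes f :: "'k::field_char_0 free_alg"
  assumes U: "free_alg.subspace U" and dil: "\<And>b f. f \<in> U \<Longrightarrow> dilate b f \<in> U"
    and A: "finite A" and f: "f \<in> U"
  shows "multilinear_part A f \<in> U"
proof -
  define e :: "nat \<Rightarrow> nat" where "e b = (if b \<in> A then 1 else 0)" for b
  have *: "keep_words {w. \<forall>b\<in>V. count_list w b = e b} f \<in> U" if "finite V" for V
    using that
  proof induction
    case empty
    have "keep_words {w. \<forall>b\<in>{}. count_list w b = e b} f = f" by (rule poly_mapping_eqI) simp
    then show ?case using f by simp
  next
    case (insert b V)
    let ?g = "keep_words {w. \<forall>b\<in>V. count_list w b = e b} f"
    have "keep_words {w. count_list w b = e b} ?g \<in> U"
      by (rule homogeneous_component_in_subspace[OF U dil, of "(\<lambda>w. count_list w b) ` Poly_Mapping.keys ?g"])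
        (use insert.IH in auto)
    moreover have "keep_words {w. count_list w b = e b} ?g = keep_words {w. \<forall>b\<in>insert b V. count_list w b = e b} f"
      by (rule poly_mapping_eqI) simp
    ultimately show ?case by simp
  qed
  define V where "V = A \<union> (\<Union>w\<in>Poly_Mapping.keys f. set w)"
  have "multilinear_part A f = keep_words {w. \<forall>b\<in>V. count_list w b = e b} f"
  proof (rule poly_mapping_eqI)
    fix w
    have "w \<in> permutations_of_set A \<longleftrightarrow> (\<forall>b\<in>V. count_list w b = e b)" if "wcoeff f w \<noteq> 0"
    proof -
      have "count_list w b = e b" if "b \<notin> V" for b
      proof -
        have "b \<notin> A" "b \<notin> set w" using that \<open>wcoeff f w \<noteq> 0\<close> by (auto simp: V_def in_keys_iff)
        then show ?thesis by (simp add: e_def count_list_0_iff)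
      qed
      then show ?thesis unfolding permutations_of_set_iff_count_list e_def[symmetric] by blast
    qed
    then show "wcoeff (multilinear_part A f) w = wcoeff (keep_words {w. \<forall>b\<in>V. count_list w b = e b} f) w"
      by auto
  qed
  moreover have "finite V" using A by (simp add: V_def)
  ultimately show ?thesis using * by simp
qed

section \<open>Evaluation homomorphisms and the symmetry of T-ideals\<close>

context unital_algebra
begin

lemma eval_free_superset:
  assumes "finite S" "Poly_Mapping.keys f \<subseteq> S"
  shows "eval_free scale r f = (\<Sum>w\<in>S. scale (wcoeff f w) (prod_list (map r w)))"
  unfolding eval_free_def using assms
  by (intro sum.mono_neutral_left) (auto simp: in_keys_iff)

lemma eval_free_add: "eval_free scale r (f + g) = eval_free scale r f + eval_free scale r g"
proof -
  let ?S = "Poly_Mapping.keys f \<union> Poly_Mapping.keys g"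
  have "Poly_Mapping.keys (f + g) \<subseteq> ?S" by (rule Poly_Mapping.keys_add)
  then show ?thesis
    by (simp add: eval_free_superset[of ?S] Poly_Mapping.lookup_add scale_left_distrib sum.distrib)
qed

lemma eval_free_scale: "eval_free scale r (free_scale c f) = scale c (eval_free scale r f)"
proof -
  have "Poly_Mapping.keys (free_scale c f) \<subseteq> Poly_Mapping.keys f"
    by (auto simp: in_keys_iff lookup_free_scale)
  then show ?thesis
    by (simp add: eval_free_superset[of "Poly_Mapping.keys f"] lookup_free_scale scale_sum_right)
qed

lemma eval_free_0 [simp]: "eval_free scale r 0 = 0"
  by (simp add: eval_free_def)

lemma eval_free_sum: "eval_free scale r (sum f S) = (\<Sum>i\<in>S. eval_free scale r (f i))"
  by (induction S rule: infinite_finite_induct) (simp_all add: eval_free_add)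

lemma eval_free_word: "eval_free scale r (word w) = prod_list (map r w)"
  by (simp add: eval_free_def)

lemma eval_free_mult: "eval_free scale r (f * g) = eval_free scale r f * eval_free scale r g"
proof -
  let ?F = "Poly_Mapping.keys f" and ?G = "Poly_Mapping.keys g"
  have "f * g = (\<Sum>u\<in>?F. free_scale (wcoeff f u) (word u)) * (\<Sum>v\<in>?G. free_scale (wcoeff g v) (word v))"
    by (intro arg_cong2[of _ _ _ _ "(*)"] word_expansion) auto
  also have "\<dots> = (\<Sum>u\<in>?F. \<Sum>v\<in>?G. free_scale (wcoeff f u) (free_scale (wcoeff g v) (word (u @ v))))"
    by (simp add: sum_product free_scale_mult_left free_scale_mult_right word_mult mult.commute)
  finally have "eval_free scale r (f * g) =
      (\<Sum>u\<in>?F. \<Sum>v\<in>?G. scale (wcoeff f u) (scale (wcoeff g v) (prod_list (map r u) * prod_list (map r v))))"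
    by (simp add: eval_free_sum eval_free_scale eval_free_word)
  also have "\<dots> = eval_free scale r f * eval_free scale r g"
    by (simp add: eval_free_def sum_product scale_mult_left scale_mult_right mult.commute)
  finally show ?thesis .
qed

lemma eval_free_rename:
  assumes s: "bij s"
  shows "eval_free scale r (rename_letters s f) = eval_free scale (r \<circ> inv_into UNIV s) f"
proof -
  let ?t = "inv_into UNIV s"
  have st: "map s (map ?t w) = w" for w
    using s by (simp add: o_def bij_is_surj surj_f_inv_f)
  have ts: "map ?t (map s w) = w" for w
    using s by (simp add: o_def bij_is_inj)
  have "Poly_Mapping.keys (rename_letters s f) \<subseteq> map ?t ` Poly_Mapping.keys f"
  proof
    fix w assume "w \<in> Poly_Mapping.keys (rename_letters s f)"
    then have "map s w \<in> Poly_Mapping.keys f" using s by (simp add: in_keys_iff bij_is_inj)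
    then have "map ?t (map s w) \<in> map ?t ` Poly_Mapping.keys f" by (rule imageI)
    then show "w \<in> map ?t ` Poly_Mapping.keys f" by (simp only: ts)
  qed
  then have "eval_free scale r (rename_letters s f) =
      (\<Sum>w\<in>map ?t ` Poly_Mapping.keys f. scale (wcoeff f (map s w)) (prod_list (map r w)))"
    using s by (subst eval_free_superset) (auto simp: bij_is_inj)
  also have "\<dots> = (\<Sum>w\<in>Poly_Mapping.keys f. scale (wcoeff f (map s (map ?t w))) (prod_list (map r (map ?t w))))"
    by (rule sum.reindex_cong[OF _ refl refl]) (metis inj_onI st)
  also have "\<dots> = eval_free scale (r \<circ> ?t) f"
    by (simp only: st eval_free_def) (simp add: o_def)
  finally show ?thesis .
qed

lemma eval_free_dilate:
  "eval_free scale r (dilate b f) = eval_free scale (r(b := scale 2 (r b))) f"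
proof -
  have "prod_list (map (r(b := scale 2 (r b))) w) = scale (2 ^ count_list w b) (prod_list (map r w))" for w
    by (induction w) (simp_all add: scale_mult_left scale_mult_right mult.commute)
  moreover have "Poly_Mapping.keys (dilate b f) \<subseteq> Poly_Mapping.keys f"
    by (auto simp: in_keys_iff)
  ultimately show ?thesis
    by (simp add: eval_free_superset[of "Poly_Mapping.keys f"] mult.commute)
qed

lemma subspace_T_ideal: "free_alg.subspace (T_ideal scale)"
  by (simp add: free_alg.subspace_def T_ideal_def eval_free_add eval_free_scale)

end

text \<open>Renaming and dilating a polynomial amount to changing the assignment of its variables,
  and an identity vanishes under every assignment.\<close>

lemma symmetric_ideal_T_ideal:
  fixes scale :: "'k::field_char_0 \<Rightarrow> 'r::{ring,monoid_mult} \<Rightarrow> 'r"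
  assumes "unital_algebra scale"
  shows "symmetric_ideal (T_ideal scale)"
proof -
  interpret unital_algebra scale by fact
  show ?thesis
  proof
    fix A :: "nat set" and f assume "finite A" "f \<in> T_ideal scale"
    then show "multilinear_part A f \<in> T_ideal scale"
      by (intro multilinear_part_in_subspace subspace_T_ideal) (auto simp: T_ideal_def eval_free_dilate)
  qed (simp_all add: subspace_T_ideal, simp_all add: T_ideal_def eval_free_mult eval_free_rename)
qed

lemma codimension_add_dim:
  assumes "unital_algebra (scale :: 'k::field \<Rightarrow> 'r::{ring,monoid_mult} \<Rightarrow> 'r)"
  shows "codimension scale n + multilinear_dim (T_ideal scale) {..<n} = fact n"
proof -
  interpret unital_algebra scale by fact
  have V: "free_alg.subspace (multilinear n :: 'k free_alg set)"
    by (simp add: multilinear_eq subspace_multilinear_on)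
  have "multilinear n \<subseteq> free_alg.span (word ` permutations_of_set {..<n} :: 'k free_alg set)"
    by (simp add: multilinear_eq multilinear_on_eq_span)
  from free_alg.dim_quotient_space[OF V free_alg.subspace_inter[OF V subspace_T_ideal] Int_lower1
      multilinear_on_finite_span(1) this]
  show ?thesis
    by (simp add: codimension_def multilinear_eq dim_multilinear_on Int_commute)
qed

section \<open>Exponential generating functions\<close>

lemma sum_Pow_card:
  assumes "finite B"
  shows "(\<Sum>A\<in>Pow B. h (card A)) = (\<Sum>k\<le>card B. of_nat (card B choose k) * (h k :: 'a::semiring_1))"
proof -
  have "(\<Sum>A\<in>Pow B. h (card A)) = (\<Sum>k\<le>card B. \<Sum>A\<in>{A\<in>Pow B. card A = k}. h (card A))"
    using assms by (intro sum.group [symmetric]) (auto intro: card_mono)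
  also have "\<dots> = (\<Sum>k\<le>card B. of_nat (card B choose k) * h k)"
  proof (rule sum.cong[OF refl])
    fix k
    have "{A\<in>Pow B. card A = k} = {A. A \<subseteq> B \<and> card A = k}" by auto
    then show "(\<Sum>A\<in>{A\<in>Pow B. card A = k}. h (card A)) = of_nat (card B choose k) * h k"
      using n_subsets[OF assms, of k] by simp
  qed
  finally show ?thesis .
qed

definition dim_egf :: "'k::field free_alg set \<Rightarrow> complex fps" where
  "dim_egf I = Abs_fps (\<lambda>n. of_nat (multilinear_dim I {..<n}) / fact n)"

text \<open>For a symmetric ideal this counts minimal generators on \<open>n\<close> letters; the
  subtraction is not truncated, since the augmentation product is contained in the ideal.\<close>

definition generator_egf :: "'k::field free_alg set \<Rightarrow> complex fps" where
  "generator_egf I = Abs_fps (\<lambda>n. of_nat (multilinear_dim I {..<n} -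
     multilinear_dim (augmentation_times I) {..<n}) / fact n)"

lemma dim_egf_ideal_times_generator:
  assumes I: "symmetric_ideal I" and J: "symmetric_ideal J"
  shows "dim_egf (ideal_times I J) = dim_egf I * generator_egf J"
proof (rule fps_ext)
  fix n
  interpret I: symmetric_ideal I by fact
  interpret J: symmetric_ideal J by fact
  define d where "d k = multilinear_dim I {..<k}" for k
  define c where "c k = multilinear_dim J {..<k} - multilinear_dim (augmentation_times J) {..<k}" for k
  \<comment> \<open>By renaming, every dimension depends only on the number of letters, so the sum
    over subsets becomes a binomial convolution.\<close>
  have "multilinear_dim (ideal_times I J) {..<n} = (\<Sum>A\<in>Pow {..<n}. d (card A) * c (n - card A))"
    unfolding multilinear_dim_ideal_times[OF I J finite_lessThan]
  proof (rule sum.cong[OF refl])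
    fix A assume A: "A \<in> Pow {..<n}"
    then have fin: "finite A" "finite ({..<n} - A)" and card: "card ({..<n} - A) = n - card A"
      by (auto simp: finite_subset card_Diff_subset)
    show "multilinear_dim I A * (multilinear_dim J ({..<n} - A) -
        multilinear_dim (augmentation_times J) ({..<n} - A)) = d (card A) * c (n - card A)"
      using multilinear_dim_card[OF fin(1) finite_lessThan, of "card A" I]
        multilinear_dim_card[OF fin(2) finite_lessThan, of "n - card A" J]
        multilinear_dim_card[OF fin(2) finite_lessThan, of "n - card A" "augmentation_times J"]
      by (simp add: d_def c_def card I.rename J.rename J.augmentation_times_rename)
  qed
  also have "\<dots> = (\<Sum>k\<le>n. (n choose k) * (d k * c (n - k)))"
    using sum_Pow_card[of "{..<n}" "\<lambda>k. d k * c (n - k)"] by simp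
  finally have "dim_egf (ideal_times I J) $ n = (\<Sum>k\<le>n. of_nat (n choose k) * (of_nat (d k) * of_nat (c (n - k))) / fact n)"
    by (simp add: dim_egf_def sum_divide_distrib)
  also have "\<dots> = (\<Sum>k\<le>n. (of_nat (d k) / fact k) * (of_nat (c (n - k)) / fact (n - k)))"
    by (intro sum.cong refl) (simp add: binomial_fact)
  also have "\<dots> = (dim_egf I * generator_egf J) $ n"
    by (simp add: fps_mult_nth dim_egf_def generator_egf_def d_def c_def atLeast0AtMost)
  finally show "dim_egf (ideal_times I J) $ n = (dim_egf I * generator_egf J) $ n" .
qed

lemma ideal_times_UNIV:
  assumes "symmetric_ideal J"
  shows "ideal_times UNIV J = J"
proof
  interpret symmetric_ideal J by fact
  show "ideal_times UNIV J \<subseteq> J"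
    by (auto simp: ideal_times_def intro!: free_alg.subspace_sum[OF subspace] mult_left)
  show "J \<subseteq> ideal_times UNIV J"
    using ideal_timesI[of 1 UNIV _ J] by auto
qed

lemma geom_fps_1_nth [simp]: "geom_fps 1 $ n = 1"
  using geom_mult_moebius_power_nth[of 0 n 1] by simp

lemma dim_egf_UNIV: "dim_egf UNIV = geom_fps 1"
  by (rule fps_ext) (simp add: dim_egf_def dim_multilinear_on)

lemma dim_egf_ideal_times:
  assumes I: "symmetric_ideal I" and J: "symmetric_ideal J"
  shows "dim_egf (ideal_times I J) = dim_egf I * ((1 - fps_X) * dim_egf J)"
proof -
  \<comment> \<open>The product formula for the whole algebra as left factor; it is solved for
    \<open>generator_egf J\<close>.\<close>
  have "dim_egf J = geom_fps 1 * generator_egf J"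
    using dim_egf_ideal_times_generator[OF symmetric_ideal_UNIV J]
    by (simp add: ideal_times_UNIV[OF J] dim_egf_UNIV)
  then have "(1 - fps_X) * dim_egf J = (geom_fps 1 * (1 - fps_const 1 * fps_X)) * generator_egf J"
    by (simp add: mult_ac)
  then show ?thesis
    unfolding geom_fps_mult by (simp add: dim_egf_ideal_times_generator[OF I J])
qed

lemma borel_codimension_series:
  assumes "unital_algebra scale"
  shows "fps_borel (codimension_series scale) = geom_fps 1 - dim_egf (T_ideal scale)"
proof (rule fps_ext)
  fix n
  have "of_nat (codimension scale n) + of_nat (multilinear_dim (T_ideal scale) {..<n}) = (fact n :: complex)"
    using codimension_add_dim[OF assms, of n] by (metis of_nat_add of_nat_fact)
  then show "fps_borel (codimension_series scale) $ n = (geom_fps 1 - dim_egf (T_ideal scale)) $ n"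
    by (simp add: fps_borel_def codimension_series_def dim_egf_def field_simps)
qed

text \<open>Under the Laplace transform the product of exponential series becomes \<open>s\<close>,
  and the additional factor \<open>t\<close> becomes the operator taking \<open>s\<close> to
  \<open>t d/dt (t s)\<close>.\<close>

lemma codimension_series_ideal_times:
  fixes scale1 :: "'k::field_char_0 \<Rightarrow> 'a::{ring,monoid_mult} \<Rightarrow> 'a"
    and scale2 :: "'k \<Rightarrow> 'b::{ring,monoid_mult} \<Rightarrow> 'b"
    and scale :: "'k \<Rightarrow> 'c::{ring,monoid_mult} \<Rightarrow> 'c"
  assumes "unital_algebra scale1" "unital_algebra scale2" "unital_algebra scale"
    and T: "T_ideal scale = ideal_times (T_ideal scale1) (T_ideal scale2)"
  defines "s \<equiv> fps_shuffle (codimension_series scale1) (codimension_series scale2)"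
  shows "codimension_series scale = codimension_series scale1 + codimension_series scale2 +
    fps_X * fps_deriv (fps_X * s) + fps_const (- 1) * s"
proof -
  let ?c1 = "fps_borel (codimension_series scale1)" and ?c2 = "fps_borel (codimension_series scale2)"
  let ?g = "geom_fps 1 :: complex fps" and ?u = "1 - fps_X :: complex fps"
  have g: "?g * ?u = 1" using geom_fps_mult[of "1 :: complex"] by simp
  have "dim_egf (T_ideal scale) = (?g - ?c1) * (?u * (?g - ?c2))"
    using dim_egf_ideal_times[OF symmetric_ideal_T_ideal[OF assms(1)] symmetric_ideal_T_ideal[OF assms(2)]]
    by (simp add: T borel_codimension_series[OF assms(1)] borel_codimension_series[OF assms(2)])
  \<comment> \<open>Grouping the factors \<open>?g * ?u = 1\<close> leaves
    \<open>?g - ?c1 - ?c2 + ?u * (?c1 * ?c2)\<close>, whose difference from \<open>?g\<close> is the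
    exponential codimension series of the product.\<close>
  also have "\<dots> = (?g * ?u) * ?g - (?g * ?u) * ?c1 - (?g * ?u) * ?c2 + ?u * (?c1 * ?c2)"
    by (simp add: algebra_simps)
  finally have "fps_borel (codimension_series scale) = ?c1 + ?c2 + fps_X * (?c1 * ?c2) + fps_const (- 1) * (?c1 * ?c2)"
    unfolding borel_codimension_series[OF assms(3)] g
    by (simp add: algebra_simps fps_const_neg [symmetric] del: fps_const_neg)
  then have "fps_laplace (fps_borel (codimension_series scale)) =
      fps_laplace (?c1 + ?c2 + fps_X * (?c1 * ?c2) + fps_const (- 1) * (?c1 * ?c2))" by simp
  then show ?thesis
    by (simp only: laplace_add laplace_const laplace_X_mult laplace_borel s_def fps_shuffle_def)
qed

theorem theorem8:
  fixes scale1 :: "'k::field_char_0 \<Rightarrow> 'a::{ring,monoid_mult} \<Rightarrow> 'a"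
    and scale2 :: "'k \<Rightarrow> 'b::{ring,monoid_mult} \<Rightarrow> 'b"
    and scale :: "'k \<Rightarrow> 'c::{ring,monoid_mult} \<Rightarrow> 'c"
  assumes "PI_algebra scale1" and "PI_algebra scale2" and "PI_algebra scale"
    and "T_ideal scale = ideal_times (T_ideal scale1) (T_ideal scale2)"
  shows "(rational_series (codimension_series scale1) \<and> rational_series (codimension_series scale2)
            \<longrightarrow> rational_series (codimension_series scale)) \<and>
         (rational_series (codimension_series scale1) \<and> algebraic_series (codimension_series scale2)
            \<longrightarrow> algebraic_series (codimension_series scale))"
proof -
  let ?s = "fps_shuffle (codimension_series scale1) (codimension_series scale2)"
  let ?c = "codimension_series scale1 + codimension_series scale2 +
    fps_X * fps_deriv (fps_X * ?s) + fps_const (- 1) * ?s"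
  have eq: "codimension_series scale = ?c"
    by (intro codimension_series_ideal_times PI_algebra.axioms(1)[OF assms(1)]
      PI_algebra.axioms(1)[OF assms(2)] PI_algebra.axioms(1)[OF assms(3)] assms(4))
  show ?thesis
    unfolding eq
  proof (intro conjI impI; elim conjE)
    assume "rational_series (codimension_series scale1)" "rational_series (codimension_series scale2)"
    then show "rational_series ?c"
      by (intro rational_series_add rational_series_mult rational_series_deriv rational_series_shuffle
        rational_series_X rational_series_const)
  next
    assume "rational_series (codimension_series scale1)" "algebraic_series (codimension_series scale2)"
    then show "algebraic_series ?c"
      by (intro algebraic_series_add algebraic_series_mult algebraic_series_deriv algebraic_series_shuffle
        rational_imp_algebraic_series[OF rational_series_X] rational_imp_algebraic_series[OF rational_series_const]
        rational_imp_algebraic_series[of "codimension_series scale1"])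
  qed
qed

end
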